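(* Let $(X^{(a)}(t))_{t\ge 0}$, $a\in\ell\setminus\{0\}$, be a family of irreducible discrete time birth and death chains on rooted trees $I_a$, indexed by the non-root vertices $a$ of an infinite path $\ell$ starting at the root, and suppose the family satisfies the $0^{\ell}$-SD condition (strong drift toward $0$ along the path $\ell$). Then $$\lim_{a\to\infty}\frac{\mathbb{E}\left[T^{(a)}_{a\to 0}\right]}{\mathbb{E}\left[T^{(a)}_{0\to a}\right]}=0 .$$
   Context: Tree notation. A tree is a connected undirected graph without cycles; one vertex, denoted $0$, is chosen as root. For a tree with vertex set $I$, put $J=I\setminus\{0\}$. Write $x\preceq y$ if $x$ lies on the path from $y$ to $0$ (including $x=y$). Each $x\in J$ has a unique parent $p(x)$ (the neighbor of $x$ with $p(x)\preceq x$). $d(x)$ is the length of the path from $x$ to $0$; $\ell(x)=\{x_0,x_1,\dots,x_{d(x)-1}\}$ with $x_i=p^i(x)$ is the set of vertices on that path except $0$; $\alpha(x)=x_{d(x)-1}$ is the last vertex before $0$ on that path. $\sigma(x)=\{y: p(y)=x\}$ is the set of children of $x$ and $B_x=\{y: x\preceq y\}$ is the branch stemming from $x$. Chains. A birth and death chain on $I$ is a Markov chain $X(t)$, $t=0,1,2,\dots$, with transition probabilities $\lambda_x=P(p(x),x)>0$ and $\mu_x=P(x,p(x))>0$ for $x\in J$, and possibly waiting probabilities $\kappa_x=P(x,x)\ge 0$ for $x\in I$, all other transition probabilities being $0$; thus $\mu_x+\kappa_x+\sum_{y\in\sigma(x)}\lambda_y=1$ for $x\in J$ and $\kappa_0+\sum_{x\in\sigma(0)}\lambda_x=1$.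 If $I$ is infinite, it is assumed that $\sum_{x\in I}\prod_{y\in\ell(x)}\lambda_y/\mu_y<\infty$. The chain is then positive recurrent with unique (reversible) invariant probability measure $\pi(x)=\pi(0)\prod_{y\in\ell(x)}\lambda_y/\mu_y$. Hitting times: $T_{x\to y}=\min\{t\ge 0: X^x(t)=y\}$, where $X^x$ is the chain started at $x$. Families. $\ell$ is an infinite path $0=v_0,v_1,v_2,\dots$. For each $a=v_n$ with $n\ge 1$, $I_a$ is a tree rooted at $0$ containing the vertices $v_0,\dots,v_n$ with $p(v_k)=v_{k-1}$ for $1\le k\le n$ (so $d(a)=n$ and $\ell(a)=\{v_1,\dots,v_n\}$), and $X^{(a)}$ is a birth and death chain on $I_a$, that is, a Markov chain on $I_a$ with transition probabilities $\lambda^{(a)}_x=P^{(a)}(p(x),x)>0$ and $\mu^{(a)}_x=P^{(a)}(x,p(x))>0$ for $x\in I_a\setminus\{0\}$, possibly waiting probabilities $\kappa^{(a)}_x=P^{(a)}(x,x)\ge 0$ for $x\in I_a$, and all other transition probabilities equal to $0$, satisfying $\sum_{x\in I_a}\prod_{y\in\ell(x)}\lambda^{(a)}_y/\mu^{(a)}_y<\infty$ if $I_a$ is infinite. Quantities of $X^{(a)}$ carry the superscript $(a)$; branches are taken in $I_a$. The transition probabilities may depend on $a$. "$a\to\infty$" means $a\in\ell$ and $d(a)\to\infty$. $0^\ell$-SD condition. (i) There is a constant $K_\mu>0$ such that $\inf_{b\in B_{\alpha(a)}}\mu^{(a)}_b\ge K_\mu$ for all $a\in\ell\setminus\{0\}$;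 (ii) the quantity $K_a=\sup_{b\in B_{\alpha(a)}}\mu^{(a)}_b\,\mathbb{E}[T^{(a)}_{b\to p(b)}]$ satisfies $K_a^2/\mathbb{E}[T^{(a)}_{a\to 0}]\to 0$ as $a\to\infty$. (Equivalently $K_a=\sup_{b\in B_{\alpha(a)}}\pi^{(a)}(B_b)/\pi^{(a)}(b)$.) *)

theory Defs
  imports "HOL-Probability.Probability"
begin

section \<open>Rooted trees\<close>

text \<open>A simple undirected graph, possibly infinite, has vertex set \<open>V\<close> and a set \<open>E\<close> of
  two-element edges.  Walks, paths and cycles are lists of vertices.\<close>

definition simple_graph :: "'v set \<Rightarrow> 'v set set \<Rightarrow> bool" where
  "simple_graph V E \<longleftrightarrow> (\<forall>e\<in>E. \<exists>u\<in>V. \<exists>w\<in>V. u \<noteq> w \<and> e = {u, w})"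

definition is_path :: "'v set set \<Rightarrow> 'v \<Rightarrow> 'v list \<Rightarrow> 'v \<Rightarrow> bool" where
  "is_path E x xs y \<longleftrightarrow>
     xs \<noteq> [] \<and> hd xs = x \<and> last xs = y \<and> distinct xs \<and> successively (\<lambda>u w. {u, w} \<in> E) xs"

definition is_cycle :: "'v set set \<Rightarrow> 'v list \<Rightarrow> bool" where
  "is_cycle E xs \<longleftrightarrow>
     3 \<le> length xs \<and> distinct xs \<and> successively (\<lambda>u w. {u, w} \<in> E) xs \<and> {last xs, hd xs} \<in> E"

definition rooted_tree :: "'v set \<Rightarrow> 'v set set \<Rightarrow> 'v \<Rightarrow> bool" where
  "rooted_tree V E r \<longleftrightarrow>
     simple_graph V E \<and> (\<forall>x\<in>V. \<forall>y\<in>V. \<exists>xs. is_path E x xs y) \<and> (\<nexists>xs. is_cycle E xs) \<and> r \<in> V"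

definition root_path :: "'v set set \<Rightarrow> 'v \<Rightarrow> 'v \<Rightarrow> 'v list" where
  "root_path E r x = (THE xs. is_path E x xs r)"

definition tree_le :: "'v set set \<Rightarrow> 'v \<Rightarrow> 'v \<Rightarrow> 'v \<Rightarrow> bool" where
  "tree_le E r x y \<longleftrightarrow> x \<in> set (root_path E r y)"

text \<open>Only meaningful for \<open>x \<noteq> r\<close>.\<close>

definition parent :: "'v set set \<Rightarrow> 'v \<Rightarrow> 'v \<Rightarrow> 'v" where
  "parent E r x = (THE y. {x, y} \<in> E \<and> tree_le E r y x)"

definition depth :: "'v set set \<Rightarrow> 'v \<Rightarrow> 'v \<Rightarrow> nat" where
  "depth E r x = length (root_path E r x) - 1"

text \<open>The vertices other than \<open>r\<close> on the path from \<open>x\<close> to \<open>r\<close>, and the last of them before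
  \<open>r\<close> (the latter only for \<open>x \<noteq> r\<close>).\<close>

definition ell :: "'v set set \<Rightarrow> 'v \<Rightarrow> 'v \<Rightarrow> 'v set" where
  "ell E r x = (\<lambda>i. (parent E r ^^ i) x) ` {..<depth E r x}"

definition alpha :: "'v set set \<Rightarrow> 'v \<Rightarrow> 'v \<Rightarrow> 'v" where
  "alpha E r x = (parent E r ^^ (depth E r x - 1)) x"

definition children :: "'v set \<Rightarrow> 'v set set \<Rightarrow> 'v \<Rightarrow> 'v \<Rightarrow> 'v set" where
  "children V E r x = {y \<in> V - {r}. parent E r y = x}"

definition branch :: "'v set \<Rightarrow> 'v set set \<Rightarrow> 'v \<Rightarrow> 'v \<Rightarrow> 'v set" where
  "branch V E r x = {y \<in> V. tree_le E r x y}"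


section \<open>Birth and death chains\<close>

text \<open>Row \<open>x\<close> of the transition matrix is the distribution \<open>P x\<close>, so the transition probability
  from \<open>x\<close> to \<open>y\<close> is \<open>pmf (P x) y\<close>, and nonnegativity and unit row sums are automatic.\<close>

definition birth_rate :: "'v set set \<Rightarrow> 'v \<Rightarrow> ('v \<Rightarrow> 'v pmf) \<Rightarrow> 'v \<Rightarrow> real" where
  "birth_rate E r P x = pmf (P (parent E r x)) x"

definition death_rate :: "'v set set \<Rightarrow> 'v \<Rightarrow> ('v \<Rightarrow> 'v pmf) \<Rightarrow> 'v \<Rightarrow> real" where
  "death_rate E r P x = pmf (P x) (parent E r x)"

definition birth_death_kernel ::
    "'v set \<Rightarrow> 'v set set \<Rightarrow> 'v \<Rightarrow> ('v \<Rightarrow> 'v pmf) \<Rightarrow> bool" where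
  "birth_death_kernel V E r P \<longleftrightarrow>
     (\<forall>x\<in>V - {r}. birth_rate E r P x > 0 \<and> death_rate E r P x > 0) \<and>
     (\<forall>x\<in>V. \<forall>y. y \<noteq> x \<and> y \<notin> children V E r x \<and> \<not> (x \<noteq> r \<and> y = parent E r x)
        \<longrightarrow> pmf (P x) y = 0) \<and>
     (infinite V \<longrightarrow>
        (\<lambda>x. \<Prod>y\<in>ell E r x. birth_rate E r P y / death_rate E r P y) summable_on V)"

definition irreducible_kernel :: "'v set \<Rightarrow> ('v \<Rightarrow> 'v pmf) \<Rightarrow> bool" where
  "irreducible_kernel V P \<longleftrightarrow>
     (\<forall>x\<in>V. \<forall>y\<in>V. (x, y) \<in> {(u, w). u \<in> V \<and> w \<in> V \<and> pmf (P u) w > 0}\<^sup>*)"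

text \<open>\<open>X\<close> is a Markov chain with state space \<open>V\<close> and transition probabilities \<open>P\<close>, started at
  \<open>x\<close>.  The last clause is the Markov property, multiplied out so that histories of
  probability 0 need no separate treatment.\<close>

definition markov_chain_from ::
    "'w measure \<Rightarrow> 'v set \<Rightarrow> ('v \<Rightarrow> 'v pmf) \<Rightarrow> 'v \<Rightarrow> (nat \<Rightarrow> 'w \<Rightarrow> 'v) \<Rightarrow> bool" where
  "markov_chain_from M V P x X \<longleftrightarrow>
     prob_space M \<and>
     (\<forall>t. X t \<in> measurable M (count_space V)) \<and>
     (AE \<omega> in M. X 0 \<omega> = x) \<and>
     (\<forall>t (s :: nat \<Rightarrow> 'v).
        measure M {\<omega> \<in> space M. \<forall>i\<le>Suc t. X i \<omega> = s i} =
        measure M {\<omega> \<in> space M. \<forall>i\<le>t. X i \<omega> = s i} * pmf (P (s t)) (s (Suc t)))"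

text \<open>The infimum of the empty set is \<open>\<infinity>\<close>.\<close>

definition hitting_time :: "(nat \<Rightarrow> 'w \<Rightarrow> 'v) \<Rightarrow> 'v \<Rightarrow> 'w \<Rightarrow> enat" where
  "hitting_time X y \<omega> = (INF t\<in>{t. X t \<omega> = y}. enat t)"

text \<open>Here \<open>X x\<close>, defined on the probability space \<open>M x\<close>, is the chain started at \<open>x\<close>.\<close>

definition mean_hitting_time ::
    "('v \<Rightarrow> 'w measure) \<Rightarrow> ('v \<Rightarrow> nat \<Rightarrow> 'w \<Rightarrow> 'v) \<Rightarrow> 'v \<Rightarrow> 'v \<Rightarrow> ennreal" where
  "mean_hitting_time M X x y = (\<integral>\<^sup>+ \<omega>. ennreal_of_enat (hitting_time (X x) y \<omega>) \<partial>M x)"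


section \<open>The strong drift condition\<close>

definition SD_sup ::
    "'v set \<Rightarrow> 'v set set \<Rightarrow> 'v \<Rightarrow> ('v \<Rightarrow> 'v pmf) \<Rightarrow>
     ('v \<Rightarrow> 'w measure) \<Rightarrow> ('v \<Rightarrow> nat \<Rightarrow> 'w \<Rightarrow> 'v) \<Rightarrow> 'v \<Rightarrow> ennreal" where
  "SD_sup V E r P M X a =
     (SUP b\<in>branch V E r (alpha E r a).
        ennreal (death_rate E r P b) * mean_hitting_time M X b (parent E r b))"

text \<open>The path is \<open>v 0, v 1, \<dots>\<close> with root \<open>v 0\<close>, and the chains are indexed by its vertices
  \<open>v n\<close>, \<open>n \<ge> 1\<close>.  \<open>SD_sup\<close> may be \<open>\<infinity>\<close>; the limit is taken in \<open>ennreal\<close>.\<close>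

definition SD_condition ::
    "(nat \<Rightarrow> 'v) \<Rightarrow> ('v \<Rightarrow> 'v set) \<Rightarrow> ('v \<Rightarrow> 'v set set) \<Rightarrow> ('v \<Rightarrow> 'v \<Rightarrow> 'v pmf) \<Rightarrow>
     ('v \<Rightarrow> 'v \<Rightarrow> 'w measure) \<Rightarrow> ('v \<Rightarrow> 'v \<Rightarrow> nat \<Rightarrow> 'w \<Rightarrow> 'v) \<Rightarrow> bool" where
  "SD_condition v I E P M X \<longleftrightarrow>
     (\<exists>K\<^sub>\<mu>>0. \<forall>a\<in>v ` {1..}.
        (INF b\<in>branch (I a) (E a) (v 0) (alpha (E a) (v 0) a). death_rate (E a) (v 0) (P a) b)
          \<ge> K\<^sub>\<mu>) \<and>
     (\<lambda>n. let a = v n in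
        (SD_sup (I a) (E a) (v 0) (P a) (M a) (X a) a)\<^sup>2 / mean_hitting_time (M a) (X a) a (v 0))
       \<longlonglongrightarrow> 0"

end

theory Submission
  imports Defs
begin

text \<open>
  Write \<open>\<rho>(x) = \<Prod>\<^bsub>y\<in>\<ell>(x)\<^esub> \<lambda>\<^sub>y/\<mu>\<^sub>y\<close> for the unnormalised reversible measure, \<open>W(y)\<close> for the
  \<open>\<rho>\<close>-mass of the branch stemming from \<open>y\<close>, and \<open>c\<^sub>y = 1/(\<rho>(y) \<mu>\<^sub>y)\<close> for the resistance of
  the edge from \<open>y\<close> to its parent.  Let \<open>a = v\<^sub>n\<close> and let \<open>A\<close>, \<open>B\<close> be the mean hitting times
  from \<open>a\<close> to the root and from the root to \<open>a\<close>.  Two bounds on them are needed.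

  The first is the upper bound \<open>A \<le> \<Sum>\<^bsub>1\<le>j\<le>n\<^esub> c\<^sub>j W(v\<^sub>j)\<close>, where \<open>c\<^sub>j\<close> is the resistance of the
  edge from \<open>v\<^sub>j\<close> to \<open>v\<^bsub>j-1\<^esub>\<close>; it shows also that \<open>A\<close> is finite.
  The second is the lower bound \<open>B \<ge> \<Sum>\<^bsub>1\<le>j\<le>n\<^esub> c\<^sub>j S\<^sub>j\<close> with \<open>S\<^sub>j = \<Sum>\<^bsub>i<j\<^esub> \<rho>(v\<^sub>i)\<close>, in which
  only the mass on the path itself is counted, not that of the branches growing out of it.
  Both come from one potential, \<open>u\<^sub>z(x) =\<close> the total resistance common to the paths from
  \<open>z\<close> and from \<open>x\<close> to the root, for which a telescoping computation gives
  \<open>u\<^sub>z - P u\<^sub>z = 1\<^sub>z/\<rho>(z) - 1\<^sub>0\<close> (lemma \<open>expectation_green\<close>).  Suitable linear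
  combinations of these functions satisfy \<open>f - P f \<ge> 1\<close> or \<open>f - P f \<le> 1\<close> off the target, and
  comparison with such a function bounds a mean hitting time from above or, if it is bounded and vanishes at
  the target, from below (lemmas \<open>expected_hitting_time_le\<close> and \<open>le_expected_hitting_time\<close>).
  The same lower comparison, applied to the hitting of the parent of \<open>b\<close> from \<open>b\<close>, turns the
  drift quantity \<open>K = K\<^sub>a\<close> into a statement about masses: \<open>W(b) \<le> K \<rho>(b)\<close>
  (lemma \<open>weight_le\<close>).

  The rest is arithmetic (lemma \<open>path_sum_bound\<close>).  Fix \<open>m \<ge> 1\<close>.  A term with \<open>j \<le> m\<close>
  satisfies \<open>c\<^sub>j W(v\<^sub>j) \<le> K/k\<close>, where \<open>k\<close> bounds the death rates from below.  If
  \<open>j > m\<close>, then, as the masses \<open>W\<close> decrease along the path,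
  \<open>m W(v\<^sub>j) \<le> \<Sum>\<^bsub>j-m\<le>i<j\<^esub> W(v\<^sub>i) \<le> K S\<^sub>j\<close>.  Hence \<open>A \<le> m K/k + (K/m) B\<close>.  Since
  \<open>\<rho>(b) \<le> W(b) \<le> K \<rho>(b)\<close> gives \<open>K \<ge> 1\<close>, the choice of \<open>C K\<close> rounded up for \<open>m\<close> leads to
  \<open>A \<le> (C+1) K\<^sup>2/k + B/C\<close>.  As \<open>K\<^sup>2/A\<close> tends to 0, the first term is at most \<open>A/2\<close> for
  large \<open>n\<close>.  So \<open>A/B \<le> 2/C\<close> eventually, for every \<open>C > 0\<close>.
\<close>


section \<open>Paths to the root\<close>

lemma is_path_Cons_iff:
  "is_path E x (x # y # xs) z \<longleftrightarrow> {x, y} \<in> E \<and> x \<notin> set (y # xs) \<and> is_path E y (y # xs) z"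
  by (auto simp: is_path_def)

lemma is_path_self: "is_path E x xs x \<Longrightarrow> xs = [x]"
  by (cases xs) (auto simp: is_path_def split: if_splits)

lemma successively_rev_edges:
  "successively (\<lambda>u w. {u, w} \<in> E) (rev xs) \<longleftrightarrow> successively (\<lambda>u w. {u, w} \<in> E) xs"
  by (simp add: successively_rev insert_commute)

text \<open>The cycle runs along the first path up to the first vertex \<open>w\<close> that lies on the second
  one, and then back along the second path.\<close>

lemma cycle_of_diverging_paths:
  assumes "is_path E x (x # y # xs) z" and "is_path E x (x # y' # ys) z" and "y \<noteq> y'"
  shows "\<exists>cs. is_cycle E cs"
proof -
  have "last (y # xs) = last (y' # ys)" using assms by (auto simp: is_path_def)
  then have "\<exists>w\<in>set (y # xs). w \<in> set (y' # ys)"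
    by (metis last_in_set list.distinct(1))
  then obtain as w bs where s1: "y # xs = as @ w # bs" "w \<in> set (y' # ys)"
    and as: "\<forall>u\<in>set as. u \<notin> set (y' # ys)"
    by (rule split_list_first_propE) blast
  obtain cs ds where s2: "y' # ys = cs @ w # ds"
    using s1(2) by (meson split_list)
  define C where "C = x # as @ w # rev cs"
  have d1: "distinct (x # as @ w # bs)" and d2: "distinct (x # cs @ w # ds)"
    using assms(1,2) unfolding is_path_def s1(1) s2 by auto
  have p1: "successively (\<lambda>u w. {u, w} \<in> E) (x # as @ w # bs)"
    and p2: "successively (\<lambda>u w. {u, w} \<in> E) (x # cs @ w # ds)"
    using assms(1,2) unfolding is_path_def s1(1) s2 by auto
  have "successively (\<lambda>u w. {u, w} \<in> E) ((x # as @ [w]) @ bs)" using p1 by simp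
  then have q1: "successively (\<lambda>u w. {u, w} \<in> E) (x # as @ [w])"
    unfolding successively_append_iff by blast
  have "successively (\<lambda>u w. {u, w} \<in> E) ([x] @ (cs @ [w]) @ ds)" using p2 by simp
  then have "successively (\<lambda>u w. {u, w} \<in> E) (cs @ [w])"
    unfolding successively_append_iff by blast
  then have q2: "successively (\<lambda>u w. {u, w} \<in> E) (w # rev cs)"
    using successively_rev_edges[of E "cs @ [w]"] by simp
  have "successively (\<lambda>u w. {u, w} \<in> E) ((x # as) @ (w # rev cs))"
    using q1 q2 unfolding successively_append_iff[of _ "x # as" "w # rev cs"]
    using successively_append_iff[of "\<lambda>u w. {u, w} \<in> E" "x # as" "[w]"] by simp
  then have "successively (\<lambda>u w. {u, w} \<in> E) C" by (simp add: C_def)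
  moreover have "distinct C"
    using d1 d2 as s2 by (auto simp: C_def)
  \<comment> \<open>If both were empty, the paths would share their second vertex \<open>w\<close>.\<close>
  moreover have "as \<noteq> [] \<or> cs \<noteq> []"
    using s1(1) s2 assms(3) by auto
  then have "3 \<le> length C" by (cases as; cases cs) (auto simp: C_def)
  moreover have "last C = y'"
    using s2 by (cases cs) (auto simp: C_def)
  then have "{last C, hd C} \<in> E"
    using assms(2) by (simp add: C_def is_path_def insert_commute)
  ultimately show ?thesis unfolding is_cycle_def by blast
qed

lemma acyclic_path_unique:
  assumes "\<nexists>cs. is_cycle E cs" and "is_path E x xs z" and "is_path E x ys z"
  shows "xs = ys"
  using assms(2,3)
proof (induction xs arbitrary: x ys)
  case Nil
  then show ?case by (simp add: is_path_def)
next
  case (Cons u xs)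
  have [simp]: "u = x" using Cons.prems(1) by (simp add: is_path_def)
  show ?case
  proof (cases "z = x")
    case True
    then show ?thesis using Cons.prems is_path_self by metis
  next
    case False
    then obtain y xs' where xs: "xs = y # xs'"
      using Cons.prems(1) by (cases xs) (auto simp: is_path_def)
    from False obtain y' ys' where ys: "ys = x # y' # ys'"
      using Cons.prems(2) by (cases ys; cases "tl ys") (auto simp: is_path_def)
    have "y = y'"
      using cycle_of_diverging_paths[of E x y xs' z y' ys'] Cons.prems assms(1) xs ys by auto
    then have "xs = y # ys'"
      using Cons.IH[of y "y # ys'"] Cons.prems unfolding xs ys by (simp add: is_path_Cons_iff)
    then show ?thesis using ys \<open>y = y'\<close> by simp
  qed
qed

locale tree =
  fixes V :: "'v set" and E :: "'v set set" and r :: 'v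
  assumes rooted_tree: "rooted_tree V E r"
begin

abbreviation "par \<equiv> parent E r"
abbreviation "rp \<equiv> root_path E r"

lemma edge_in: "{x, y} \<in> E \<Longrightarrow> x \<in> V \<and> y \<in> V \<and> x \<noteq> y"
  using rooted_tree unfolding rooted_tree_def simple_graph_def
  by (metis doubleton_eq_iff)

lemma root_in [simp]: "r \<in> V"
  using rooted_tree by (simp add: rooted_tree_def)

lemma root_path_eqI: "is_path E x xs r \<Longrightarrow> rp x = xs"
  unfolding root_path_def
  using acyclic_path_unique rooted_tree unfolding rooted_tree_def by (metis the_equality)

lemma is_path_root_path: "x \<in> V \<Longrightarrow> is_path E x (rp x) r"
  using root_path_eqI rooted_tree unfolding rooted_tree_def by metis

lemma root_path_root [simp]: "rp r = [r]"
  by (rule root_path_eqI) (simp add: is_path_def)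

lemma root_path_parent:
  assumes x: "x \<in> V" "x \<noteq> r"
  shows "rp x = x # rp (par x)" and "par x \<in> V"
proof -
  note p = is_path_root_path[OF x(1)]
  obtain y ys where xs: "rp x = x # y # ys"
    using p x(2) by (cases "rp x"; cases "tl (rp x)") (auto simp: is_path_def)
  have e: "{x, y} \<in> E" and py: "is_path E y (y # ys) r"
    using p unfolding xs by (auto simp: is_path_Cons_iff)
  have "par x = y" unfolding parent_def tree_le_def
  proof (rule the_equality)
    show "{x, y} \<in> E \<and> y \<in> set (rp x)" using e xs by simp
  next
    fix w assume w: "{x, w} \<in> E \<and> w \<in> set (rp x)"
    show "w = y"
    proof (rule ccontr)
      assume "w \<noteq> y"
      then have "w \<in> set ys" using w edge_in[of x w] xs by auto
      then obtain us vs where us: "ys = us @ w # vs" by (meson split_list)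
      \<comment> \<open>A second neighbour \<open>w\<close> of \<open>x\<close> on its path to the root closes the segment from \<open>x\<close> to
        \<open>w\<close> to a cycle.\<close>
      have "is_cycle E (x # y # us @ [w])"
        using p w unfolding xs us is_path_def is_cycle_def
        using successively_append_iff[of "\<lambda>u w. {u, w} \<in> E" "x # y # us @ [w]" vs]
        by (auto simp: insert_commute)
      then show False using rooted_tree unfolding rooted_tree_def by blast
    qed
  qed
  then show "rp x = x # rp (par x)" "par x \<in> V"
    using root_path_eqI[OF py] xs edge_in[OF e] by auto
qed

lemma distinct_root_path: "x \<in> V \<Longrightarrow> distinct (rp x)"
  using is_path_root_path by (auto simp: is_path_def)

lemma tree_le_root [simp]: "tree_le E r y r \<longleftrightarrow> y = r"
  by (simp add: tree_le_def)

lemma tree_le_parent_iff: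
  "x \<in> V \<Longrightarrow> x \<noteq> r \<Longrightarrow> tree_le E r y x \<longleftrightarrow> y = x \<or> tree_le E r y (par x)"
  by (simp add: tree_le_def root_path_parent)

lemma not_tree_le_parent: "x \<in> V \<Longrightarrow> x \<noteq> r \<Longrightarrow> \<not> tree_le E r x (par x)"
  using distinct_root_path[of x] by (simp add: tree_le_def root_path_parent)

lemma parent_neq: "x \<in> V \<Longrightarrow> x \<noteq> r \<Longrightarrow> par x \<noteq> x"
  using not_tree_le_parent tree_le_parent_iff by metis

lemma root_path_nonempty: "x \<in> V \<Longrightarrow> rp x \<noteq> []"
  using is_path_root_path by (auto simp: is_path_def)

lemma depth_root [simp]: "depth E r r = 0"
  by (simp add: depth_def)

lemma depth_parent: "x \<in> V \<Longrightarrow> x \<noteq> r \<Longrightarrow> depth E r x = Suc (depth E r (par x))"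
  using root_path_nonempty[of "par x"] by (simp add: depth_def root_path_parent)

lemma ell_root [simp]: "ell E r r = {}"
  by (simp add: ell_def)

lemma ell_parent:
  assumes "x \<in> V" "x \<noteq> r"
  shows "ell E r x = insert x (ell E r (par x))"
  unfolding ell_def depth_parent[OF assms] lessThan_Suc_eq_insert_0
  by (simp add: image_image funpow_swap1)

lemma tree_induct [consumes 1, case_names root parent]:
  assumes "x \<in> V" and "Q r" and "\<And>x. x \<in> V \<Longrightarrow> x \<noteq> r \<Longrightarrow> Q (par x) \<Longrightarrow> Q x"
  shows "Q x"
  using assms(1)
proof (induction "depth E r x" arbitrary: x)
  case 0
  then show ?case using assms(2) depth_parent by fastforce
next
  case (Suc n)
  then show ?case using assms(2,3) depth_parent root_path_parent(2) by (metis nat.inject)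
qed

lemma ell_eq: "x \<in> V \<Longrightarrow> ell E r x = {y. tree_le E r y x} - {r}"
  by (induction rule: tree_induct) (auto simp: ell_parent tree_le_parent_iff)

lemma tree_le_in: "tree_le E r y x \<Longrightarrow> x \<in> V \<Longrightarrow> y \<in> V"
  by (rotate_tac 1, induction rule: tree_induct) (auto simp: tree_le_parent_iff)

lemma ell_subset: "x \<in> V \<Longrightarrow> ell E r x \<subseteq> V - {r}"
  using ell_eq tree_le_in by auto

lemma finite_ell [simp]: "finite (ell E r x)"
  by (simp add: ell_def)

lemma tree_le_refl [simp]: "x \<in> V \<Longrightarrow> tree_le E r x x"
  by (cases "x = r") (auto simp: tree_le_parent_iff)

lemma tree_le_trans: "tree_le E r y x \<Longrightarrow> tree_le E r z y \<Longrightarrow> x \<in> V \<Longrightarrow> tree_le E r z x"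
  by (rotate_tac 2, induction rule: tree_induct) (auto simp: tree_le_parent_iff)

end


section \<open>Comparison bounds for mean hitting times\<close>

text \<open>Splitting an expectation according to the value of a countably valued variable reduces
  the Markov property to the elementary events on which the transition probabilities are
  prescribed.\<close>

lemma nn_integral_partition:
  assumes V: "countable V" and Y: "Y \<in> measurable M (count_space V)"
    and \<phi>: "\<phi> \<in> borel_measurable M" and M: "sigma_finite_measure M"
  shows "(\<integral>\<^sup>+\<omega>. \<phi> \<omega> \<partial>M) = (\<integral>\<^sup>+w. (\<integral>\<^sup>+\<omega>. \<phi> \<omega> * indicator {w} (Y \<omega>) \<partial>M) \<partial>count_space V)"
proof -
  interpret pair_sigma_finite "count_space V" M
    using V M by (simp add: pair_sigma_finite_def sigma_finite_measure_count_space_countable)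
  have "(\<lambda>\<omega>. \<phi> \<omega> * indicator {w} (Y \<omega>)) \<in> borel_measurable M" for w
  proof -
    have "(\<lambda>\<omega>. indicator {w} (Y \<omega>) :: ennreal) \<in> borel_measurable M"
      by (rule measurable_compose[OF Y]) simp
    then show ?thesis using \<phi> by simp
  qed
  then have "(\<lambda>(w, \<omega>). \<phi> \<omega> * indicator {w} (Y \<omega>)) \<in> borel_measurable (count_space V \<Otimes>\<^sub>M M)"
    by (intro measurable_pair_measure_countable1 V) simp
  from Fubini'[OF this]
  have "(\<integral>\<^sup>+w. (\<integral>\<^sup>+\<omega>. \<phi> \<omega> * indicator {w} (Y \<omega>) \<partial>M) \<partial>count_space V)
      = (\<integral>\<^sup>+\<omega>. (\<integral>\<^sup>+w. \<phi> \<omega> * indicator {w} (Y \<omega>) \<partial>count_space V) \<partial>M)" by simp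
  also have "\<dots> = (\<integral>\<^sup>+\<omega>. \<phi> \<omega> \<partial>M)"
  proof (rule nn_integral_cong)
    fix \<omega> assume "\<omega> \<in> space M"
    then have "Y \<omega> \<in> V" using measurable_space[OF Y] by simp
    have "(\<integral>\<^sup>+w. \<phi> \<omega> * indicator {w} (Y \<omega>) \<partial>count_space V)
        = (\<integral>\<^sup>+w. \<phi> \<omega> * indicator {Y \<omega>} w \<partial>count_space V)"
      by (intro nn_integral_cong) (auto simp: indicator_def)
    also have "\<dots> = \<phi> \<omega>" using \<open>Y \<omega> \<in> V\<close> by (simp add: one_ennreal_def[symmetric])
    finally show "(\<integral>\<^sup>+w. \<phi> \<omega> * indicator {w} (Y \<omega>) \<partial>count_space V) = \<phi> \<omega>" .
  qed
  finally show ?thesis by simp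
qed

text \<open>A hitting time counts the times up to which the target has been avoided.\<close>

lemma ennreal_hitting_time:
  "ennreal_of_enat (hitting_time X y \<omega>) = (\<Sum>t. indicator {\<omega>. \<forall>i\<le>t. X i \<omega> \<noteq> y} \<omega>)"
proof (cases "\<exists>t. X t \<omega> = y")
  case True
  define T where "T = (LEAST t. X t \<omega> = y)"
  have T: "X T \<omega> = y" using True unfolding T_def by (rule LeastI_ex)
  have T': "T \<le> t" if "X t \<omega> = y" for t using that unfolding T_def by (rule Least_le)
  have "hitting_time X y \<omega> = enat T" unfolding hitting_time_def
    using T T' by (intro antisym INF_greatest INF_lower) auto
  moreover have "(\<forall>i\<le>t. X i \<omega> \<noteq> y) \<longleftrightarrow> t < T" for t
  proof
    show "t < T" if "\<forall>i\<le>t. X i \<omega> \<noteq> y" using that T leI by blast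
    show "\<forall>i\<le>t. X i \<omega> \<noteq> y" if "t < T" using that T' by force
  qed
  then have "(\<Sum>t. indicator {\<omega>. \<forall>i\<le>t. X i \<omega> \<noteq> y} \<omega> :: ennreal) = (\<Sum>t. if t < T then 1 else 0)"
    by (intro suminf_cong) (simp add: indicator_def)
  moreover have "\<dots> = (\<Sum>t<T. 1)"
    using suminf_finite[of "{..<T}" "\<lambda>t. if t < T then 1 else 0 :: ennreal"] by simp
  ultimately show ?thesis by simp
next
  case False
  then have "hitting_time X y \<omega> = \<infinity>" by (simp add: hitting_time_def top_enat_def)
  moreover have "(\<Sum>t. indicator {\<omega>. \<forall>i\<le>t. X i \<omega> \<noteq> y} \<omega> :: ennreal) = (\<Sum>t. 1)"
    using False by (simp add: indicator_def)
  moreover have "(\<Sum>t::nat. 1 :: ennreal) = \<top>"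
    using nn_integral_count_space_nat[of "\<lambda>_. 1"] by simp
  ultimately show ?thesis by simp
qed

locale countable_chain = prob_space M for M :: "'w measure" +
  fixes V :: "'v set" and P :: "'v \<Rightarrow> 'v pmf" and x :: 'v and X :: "nat \<Rightarrow> 'w \<Rightarrow> 'v"
  assumes chain: "markov_chain_from M V P x X"
    and countable_V: "countable V"
    and support: "\<And>u. u \<in> V \<Longrightarrow> set_pmf (P u) \<subseteq> V"
begin

lemma X_measurable [measurable]: "X t \<in> measurable M (count_space V)"
  using chain by (simp add: markov_chain_from_def)

lemma X_0: "AE \<omega> in M. X 0 \<omega> = x"
  using chain by (simp add: markov_chain_from_def)

lemma X_in: "\<omega> \<in> space M \<Longrightarrow> X t \<omega> \<in> V"
  using measurable_space[OF X_measurable] by simp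

lemma X_borel [measurable]: "(\<lambda>\<omega>. (g (X t \<omega>) :: ennreal)) \<in> borel_measurable M"
  by (rule measurable_compose[OF X_measurable]) simp

lemma X_pred [measurable]: "Measurable.pred M (\<lambda>\<omega>. Q (X t \<omega>))"
  by (rule measurable_compose[OF X_measurable]) simp

abbreviation alive :: "'v \<Rightarrow> nat \<Rightarrow> 'w \<Rightarrow> ennreal" where
  "alive y t \<equiv> indicator {\<omega>. \<forall>i\<le>t. X i \<omega> \<noteq> y}"

lemma alive_measurable [measurable]: "alive y t \<in> borel_measurable M"
  by measurable

lemma cylinder:
  "measure M {\<omega> \<in> space M. \<forall>i\<le>Suc t. X i \<omega> = s i} =
   measure M {\<omega> \<in> space M. \<forall>i\<le>t. X i \<omega> = s i} * pmf (P (s t)) (s (Suc t))"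
  using chain unfolding markov_chain_from_def by blast

text \<open>The chain is specified by the probabilities of complete histories.  Here they are
  summed over the countably many histories that avoid \<open>y\<close> up to time \<open>t\<close> and end in \<open>w\<close>.\<close>

lemma one_step:
  "emeasure M {\<omega>\<in>space M. (\<forall>i\<le>t. X i \<omega> \<noteq> y) \<and> X t \<omega> = w \<and> X (Suc t) \<omega> = z} =
   emeasure M {\<omega>\<in>space M. (\<forall>i\<le>t. X i \<omega> \<noteq> y) \<and> X t \<omega> = w} * pmf (P w) z"
proof -
  define H where "H = {s \<in> PiE {..t} (\<lambda>_. V). (\<forall>i\<le>t. s i \<noteq> y) \<and> s t = w}"
  have cH: "countable H"
    unfolding H_def by (rule countable_Collect, rule countable_PiE) (auto simp: countable_V)
  have sH: "s = s'" if "s \<in> H" "s' \<in> H" "\<And>i. i \<le> t \<Longrightarrow> s i = s' i" for s s'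
    using that unfolding H_def by (intro PiE_ext[of s _ _ s']) auto
  have hist: "\<exists>s\<in>H. \<forall>i\<le>t. X i \<omega> = s i"
    if "\<omega> \<in> space M" "\<forall>i\<le>t. X i \<omega> \<noteq> y" "X t \<omega> = w" for \<omega>
    using that X_in by (intro bexI[of _ "restrict (\<lambda>i. X i \<omega>) {..t}"]) (auto simp: H_def)
  define A where "A s = {\<omega>\<in>space M. \<forall>i\<le>t. X i \<omega> = s i}" for s
  define B where "B s = {\<omega>\<in>space M. \<forall>i\<le>Suc t. X i \<omega> = (s(Suc t := z)) i}" for s
  have Bs: "B s = {\<omega>\<in>space M. (\<forall>i\<le>t. X i \<omega> = s i) \<and> X (Suc t) \<omega> = z}" for s
    unfolding B_def by (auto simp: le_Suc_eq)
  have mA: "A s \<in> sets M" and mB: "B s \<in> sets M" for s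
    unfolding A_def B_def by measurable
  have dis: "disjoint_family_on A H" "disjoint_family_on B H"
    unfolding disjoint_family_on_def A_def Bs using sH by fastforce+
  have "{\<omega>\<in>space M. (\<forall>i\<le>t. X i \<omega> \<noteq> y) \<and> X t \<omega> = w \<and> X (Suc t) \<omega> = z} = \<Union>(B ` H)"
  proof (intro equalityI subsetI)
    fix \<omega> assume *: "\<omega> \<in> {\<omega>\<in>space M. (\<forall>i\<le>t. X i \<omega> \<noteq> y) \<and> X t \<omega> = w \<and> X (Suc t) \<omega> = z}"
    with hist[of \<omega>] show "\<omega> \<in> \<Union>(B ` H)" unfolding Bs by blast
  qed (auto simp: Bs H_def)
  then have "emeasure M {\<omega>\<in>space M. (\<forall>i\<le>t. X i \<omega> \<noteq> y) \<and> X t \<omega> = w \<and> X (Suc t) \<omega> = z}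
      = (\<integral>\<^sup>+s. emeasure M (B s) \<partial>count_space H)"
    using emeasure_UN_countable[of H B, OF mB cH dis(2)] by simp
  also have "\<dots> = (\<integral>\<^sup>+s. emeasure M (A s) * pmf (P w) z \<partial>count_space H)"
  proof (rule nn_integral_cong)
    fix s assume "s \<in> space (count_space H)"
    then have "s t = w" by (simp add: H_def)
    have "measure M (B s) = measure M {\<omega> \<in> space M. \<forall>i\<le>t. X i \<omega> = (s(Suc t := z)) i} * pmf (P w) z"
      using cylinder[of t "s(Suc t := z)"] \<open>s t = w\<close> by (simp add: B_def)
    also have "{\<omega> \<in> space M. \<forall>i\<le>t. X i \<omega> = (s(Suc t := z)) i} = A s" by (auto simp: A_def)
    finally show "emeasure M (B s) = emeasure M (A s) * pmf (P w) z"
      by (simp add: emeasure_eq_measure ennreal_mult)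
  qed
  also have "\<dots> = (\<integral>\<^sup>+s. emeasure M (A s) \<partial>count_space H) * pmf (P w) z"
    by (simp add: nn_integral_multc)
  also have "(\<integral>\<^sup>+s. emeasure M (A s) \<partial>count_space H) = emeasure M (\<Union>(A ` H))"
    using emeasure_UN_countable[of H A, OF mA cH dis(1)] by simp
  also have "\<Union>(A ` H) = {\<omega>\<in>space M. (\<forall>i\<le>t. X i \<omega> \<noteq> y) \<and> X t \<omega> = w}"
  proof (intro equalityI subsetI)
    fix \<omega> assume *: "\<omega> \<in> {\<omega>\<in>space M. (\<forall>i\<le>t. X i \<omega> \<noteq> y) \<and> X t \<omega> = w}"
    with hist[of \<omega>] show "\<omega> \<in> \<Union>(A ` H)" unfolding A_def by blast
  qed (auto simp: A_def H_def)
  finally show ?thesis .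
qed

lemma nn_integral_kernel:
  assumes "w \<in> V"
  shows "(\<integral>\<^sup>+z. g z \<partial>P w) = (\<integral>\<^sup>+z. ennreal (pmf (P w) z) * g z \<partial>count_space V)"
proof -
  have "(\<integral>\<^sup>+z. ennreal (pmf (P w) z) * g z \<partial>count_space V)
      = (\<integral>\<^sup>+z. ennreal (pmf (P w) z) * g z * indicator V z \<partial>count_space UNIV)"
    by (rule nn_integral_count_space_indicator) simp
  also have "\<dots> = (\<integral>\<^sup>+z. ennreal (pmf (P w) z) * g z \<partial>count_space UNIV)"
    using support[OF assms] by (intro nn_integral_cong) (auto simp: indicator_def set_pmf_eq)
  finally show ?thesis by (simp add: nn_integral_measure_pmf)
qed

lemma markov_property:
  "(\<integral>\<^sup>+\<omega>. g (X (Suc t) \<omega>) * alive y t \<omega> \<partial>M) = (\<integral>\<^sup>+\<omega>. (\<integral>\<^sup>+z. g z \<partial>P (X t \<omega>)) * alive y t \<omega> \<partial>M)"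
proof -
  define A where "A w = {\<omega>\<in>space M. (\<forall>i\<le>t. X i \<omega> \<noteq> y) \<and> X t \<omega> = w}" for w
  define B where "B w z = {\<omega>\<in>space M. (\<forall>i\<le>t. X i \<omega> \<noteq> y) \<and> X t \<omega> = w \<and> X (Suc t) \<omega> = z}" for w z
  have mA [measurable]: "A w \<in> sets M" and mB [measurable]: "B w z \<in> sets M" for w z
    unfolding A_def B_def by measurable
  have "(\<integral>\<^sup>+\<omega>. g (X (Suc t) \<omega>) * alive y t \<omega> \<partial>M)
    = (\<integral>\<^sup>+w. (\<integral>\<^sup>+\<omega>. g (X (Suc t) \<omega>) * alive y t \<omega> * indicator {w} (X t \<omega>) \<partial>M) \<partial>count_space V)"
    by (rule nn_integral_partition[OF countable_V]) (auto intro: sigma_finite_measure_axioms)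
  also have "\<dots> = (\<integral>\<^sup>+w. (\<integral>\<^sup>+z. g z * emeasure M (B w z) \<partial>count_space V) \<partial>count_space V)"
  proof (intro nn_integral_cong)
    fix w
    have "(\<integral>\<^sup>+\<omega>. g (X (Suc t) \<omega>) * alive y t \<omega> * indicator {w} (X t \<omega>) \<partial>M)
      = (\<integral>\<^sup>+z. (\<integral>\<^sup>+\<omega>. g (X (Suc t) \<omega>) * alive y t \<omega> * indicator {w} (X t \<omega>)
          * indicator {z} (X (Suc t) \<omega>) \<partial>M) \<partial>count_space V)"
      by (rule nn_integral_partition[OF countable_V]) (auto intro: sigma_finite_measure_axioms)
    also have "\<dots> = (\<integral>\<^sup>+z. (\<integral>\<^sup>+\<omega>. g z * indicator (B w z) \<omega> \<partial>M) \<partial>count_space V)"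
      by (intro nn_integral_cong) (auto simp: indicator_def B_def)
    also have "\<dots> = (\<integral>\<^sup>+z. g z * emeasure M (B w z) \<partial>count_space V)"
      by (simp add: nn_integral_cmult_indicator)
    finally show "(\<integral>\<^sup>+\<omega>. g (X (Suc t) \<omega>) * alive y t \<omega> * indicator {w} (X t \<omega>) \<partial>M)
      = (\<integral>\<^sup>+z. g z * emeasure M (B w z) \<partial>count_space V)" .
  qed
  also have "\<dots> = (\<integral>\<^sup>+w. (\<integral>\<^sup>+z. g z \<partial>P w) * emeasure M (A w) \<partial>count_space V)"
  proof (intro nn_integral_cong)
    fix w assume "w \<in> space (count_space V)"
    then have "(\<integral>\<^sup>+z. g z \<partial>P w) * emeasure M (A w)
        = (\<integral>\<^sup>+z. ennreal (pmf (P w) z) * g z * emeasure M (A w) \<partial>count_space V)"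
      by (simp add: nn_integral_kernel nn_integral_multc)
    also have "\<dots> = (\<integral>\<^sup>+z. g z * emeasure M (B w z) \<partial>count_space V)"
      unfolding B_def one_step A_def[symmetric] by (simp add: mult_ac)
    finally show "(\<integral>\<^sup>+z. g z * emeasure M (B w z) \<partial>count_space V)
        = (\<integral>\<^sup>+z. g z \<partial>P w) * emeasure M (A w)" by simp
  qed
  also have "\<dots> = (\<integral>\<^sup>+w. (\<integral>\<^sup>+\<omega>. (\<integral>\<^sup>+z. g z \<partial>P (X t \<omega>)) * alive y t \<omega> * indicator {w} (X t \<omega>) \<partial>M)
      \<partial>count_space V)"
  proof (intro nn_integral_cong)
    fix w
    have "(\<integral>\<^sup>+\<omega>. (\<integral>\<^sup>+z. g z \<partial>P (X t \<omega>)) * alive y t \<omega> * indicator {w} (X t \<omega>) \<partial>M)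
      = (\<integral>\<^sup>+\<omega>. (\<integral>\<^sup>+z. g z \<partial>P w) * indicator (A w) \<omega> \<partial>M)"
      by (intro nn_integral_cong) (auto simp: indicator_def A_def)
    then show "(\<integral>\<^sup>+z. g z \<partial>P w) * emeasure M (A w)
      = (\<integral>\<^sup>+\<omega>. (\<integral>\<^sup>+z. g z \<partial>P (X t \<omega>)) * alive y t \<omega> * indicator {w} (X t \<omega>) \<partial>M)"
      by (simp add: nn_integral_cmult_indicator)
  qed
  also have "\<dots> = (\<integral>\<^sup>+\<omega>. (\<integral>\<^sup>+z. g z \<partial>P (X t \<omega>)) * alive y t \<omega> \<partial>M)"
    using X_borel[of "\<lambda>w. \<integral>\<^sup>+z. g z \<partial>P w" t]
    by (intro nn_integral_partition[OF countable_V, symmetric]) (auto intro: sigma_finite_measure_axioms)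
  finally show ?thesis .
qed

definition survival :: "'v \<Rightarrow> nat \<Rightarrow> ennreal" where
  "survival y t = (\<integral>\<^sup>+\<omega>. alive y t \<omega> \<partial>M)"

text \<open>The mean of \<open>f\<close> under the chain that is killed when it reaches \<open>y\<close>.\<close>

definition killed :: "'v \<Rightarrow> ('v \<Rightarrow> ennreal) \<Rightarrow> nat \<Rightarrow> ennreal" where
  "killed y f t = (\<integral>\<^sup>+\<omega>. f (X t \<omega>) * alive y t \<omega> \<partial>M)"

lemma expected_hitting_time:
  "(\<integral>\<^sup>+\<omega>. ennreal_of_enat (hitting_time X y \<omega>) \<partial>M) = (\<Sum>t. survival y t)"
  unfolding survival_def ennreal_hitting_time by (rule nn_integral_suminf) simp

lemma killed_0_le: "killed y f 0 \<le> f x"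
proof -
  have "AE \<omega> in M. f (X 0 \<omega>) * alive y 0 \<omega> \<le> f x"
    using X_0 by eventually_elim (auto simp: indicator_def)
  then have "killed y f 0 \<le> (\<integral>\<^sup>+\<omega>. f x \<partial>M)"
    unfolding killed_def by (rule nn_integral_mono_AE)
  then show ?thesis by (simp add: emeasure_space_1)
qed

lemma killed_0:
  assumes "x \<noteq> y"
  shows "killed y f 0 = f x"
proof -
  have "AE \<omega> in M. f (X 0 \<omega>) * alive y 0 \<omega> = f x"
    using X_0 by eventually_elim (use assms in \<open>auto simp: indicator_def\<close>)
  then have "killed y f 0 = (\<integral>\<^sup>+\<omega>. f x \<partial>M)"
    unfolding killed_def by (rule nn_integral_cong_AE)
  then show ?thesis by (simp add: emeasure_space_1)
qed

lemma survival_plus_step: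
  "survival y t + (\<integral>\<^sup>+\<omega>. f (X (Suc t) \<omega>) * alive y t \<omega> \<partial>M)
     = (\<integral>\<^sup>+\<omega>. (1 + (\<integral>\<^sup>+z. f z \<partial>P (X t \<omega>))) * alive y t \<omega> \<partial>M)"
  unfolding survival_def markov_property
  using X_borel[of "\<lambda>w. \<integral>\<^sup>+z. f z \<partial>P w" t]
  by (simp add: nn_integral_add[symmetric] distrib_right)

text \<open>Off \<open>y\<close>, the inequality \<open>f \<ge> 1 + P f\<close> makes \<open>f\<close> lose at least the survival probability in each
  step of the killed chain; what is lost in total is at most the initial value of \<open>f\<close>.\<close>

lemma expected_hitting_time_le:
  assumes f: "\<And>u. u \<in> V \<Longrightarrow> u \<noteq> y \<Longrightarrow> 1 + (\<integral>\<^sup>+z. f z \<partial>P u) \<le> f u"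
  shows "(\<integral>\<^sup>+\<omega>. ennreal_of_enat (hitting_time X y \<omega>) \<partial>M) \<le> f x"
proof -
  have step: "survival y t + killed y f (Suc t) \<le> killed y f t" for t
  proof -
    have "killed y f (Suc t) \<le> (\<integral>\<^sup>+\<omega>. f (X (Suc t) \<omega>) * alive y t \<omega> \<partial>M)"
      unfolding killed_def by (intro nn_integral_mono mult_left_mono) (auto simp: indicator_def)
    then have "survival y t + killed y f (Suc t)
        \<le> (\<integral>\<^sup>+\<omega>. (1 + (\<integral>\<^sup>+z. f z \<partial>P (X t \<omega>))) * alive y t \<omega> \<partial>M)"
      unfolding survival_plus_step[symmetric] by (rule add_left_mono)
    also have "\<dots> \<le> killed y f t"
      unfolding killed_def using f X_in by (intro nn_integral_mono) (auto simp: indicator_def)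
    finally show ?thesis .
  qed
  have "(\<Sum>t<N. survival y t) + killed y f N \<le> f x" for N
  proof (induction N)
    case 0
    then show ?case using killed_0_le by simp
  next
    case (Suc N)
    have "(\<Sum>t<Suc N. survival y t) + killed y f (Suc N) \<le> (\<Sum>t<N. survival y t) + killed y f N"
      unfolding sum.lessThan_Suc add.assoc by (intro add_left_mono step)
    then show ?case using Suc by (rule order_trans)
  qed
  note bound = this
  have "(\<Sum>t<N. survival y t) \<le> f x" for N
    by (rule order_trans[OF _ bound[of N]]) simp
  then show ?thesis
    unfolding expected_hitting_time by (intro suminf_le_const) auto
qed

text \<open>Off \<open>y\<close>, the inequality \<open>f \<le> 1 + P f\<close> lets \<open>f\<close> lose at most the survival probability in each
  step; since \<open>f\<close> vanishes at \<open>y\<close>, nothing is lost by the killing.  The part that is left after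
  \<open>N\<close> steps is at most \<open>C\<close> times the survival probability at time \<open>N\<close>.  It tends to 0 if the
  mean hitting time is finite, and this is where boundedness is used: on an infinite tree there may be
  an unbounded \<open>f\<close> with \<open>f y = 0\<close> and \<open>f = P f\<close> off \<open>y\<close>, and all its multiples satisfy \<open>f \<le> 1 + P f\<close>.\<close>

lemma le_expected_hitting_time:
  assumes f: "\<And>u. u \<in> V \<Longrightarrow> u \<noteq> y \<Longrightarrow> f u \<le> 1 + (\<integral>\<^sup>+z. f z \<partial>P u)"
    and f0: "f y = 0" and bdd: "\<And>u. u \<in> V \<Longrightarrow> f u \<le> C" and C: "C < \<top>"
  shows "f x \<le> (\<integral>\<^sup>+\<omega>. ennreal_of_enat (hitting_time X y \<omega>) \<partial>M)"
proof (cases "x = y \<or> (\<Sum>t. survival y t) = \<top>")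
  case True
  then show ?thesis using f0 unfolding expected_hitting_time by auto
next
  case False
  have step: "killed y f t \<le> survival y t + killed y f (Suc t)" for t
  proof -
    have "killed y f t \<le> (\<integral>\<^sup>+\<omega>. (1 + (\<integral>\<^sup>+z. f z \<partial>P (X t \<omega>))) * alive y t \<omega> \<partial>M)"
      unfolding killed_def using f X_in by (intro nn_integral_mono) (auto simp: indicator_def)
    also have "(\<integral>\<^sup>+\<omega>. f (X (Suc t) \<omega>) * alive y t \<omega> \<partial>M) = killed y f (Suc t)"
      unfolding killed_def using f0 by (intro nn_integral_cong) (auto simp: indicator_def le_Suc_eq)
    then have "(\<integral>\<^sup>+\<omega>. (1 + (\<integral>\<^sup>+z. f z \<partial>P (X t \<omega>))) * alive y t \<omega> \<partial>M) = survival y t + killed y f (Suc t)"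
      unfolding survival_plus_step[symmetric] by simp
    finally show ?thesis .
  qed
  have kC: "killed y f t \<le> C * survival y t" for t
    unfolding killed_def survival_def using bdd X_in
    by (subst nn_integral_cmult[symmetric]) (auto intro!: nn_integral_mono mult_right_mono)
  have fx: "f x \<le> (\<Sum>t<N. survival y t) + C * survival y N" for N
  proof -
    have "f x \<le> (\<Sum>t<N. survival y t) + killed y f N"
    proof (induction N)
      case 0
      then show ?case using killed_0 False by simp
    next
      case (Suc N)
      have "(\<Sum>t<N. survival y t) + killed y f N \<le> (\<Sum>t<Suc N. survival y t) + killed y f (Suc N)"
        unfolding sum.lessThan_Suc add.assoc by (intro add_left_mono step)
      then show ?case using Suc order_trans by blast
    qed
    also have "\<dots> \<le> (\<Sum>t<N. survival y t) + C * survival y N" using kC by (rule add_left_mono)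
    finally show ?thesis .
  qed
  have "survival y t \<le> 1" for t
  proof -
    have "survival y t \<le> (\<integral>\<^sup>+\<omega>. 1 \<partial>M)"
      unfolding survival_def by (intro nn_integral_mono) (auto simp: indicator_def)
    then show ?thesis by (simp add: emeasure_space_1)
  qed
  then have real: "survival y t = ennreal (enn2real (survival y t))" for t
    by (metis ennreal_enn2real le_less_trans ennreal_one_less_top)
  have "summable (\<lambda>t. enn2real (survival y t))"
    using False real by (intro summable_suminf_not_top) auto
  then have "(\<lambda>t. ennreal (enn2real (survival y t))) \<longlonglongrightarrow> ennreal 0"
    by (intro tendsto_ennrealI summable_LIMSEQ_zero)
  then have "(\<lambda>t. survival y t) \<longlonglongrightarrow> 0"
    using real by simp
  then have "(\<lambda>N. C * survival y N) \<longlonglongrightarrow> C * 0"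
    using C by (intro ennreal_tendsto_cmult)
  then have "(\<lambda>N. (\<Sum>t<N. survival y t) + C * survival y N) \<longlonglongrightarrow> (\<Sum>t. survival y t) + C * 0"
    by (intro tendsto_add summable_LIMSEQ) auto
  then show ?thesis
    unfolding expected_hitting_time using fx by (intro LIMSEQ_le_const) auto
qed

end


section \<open>The Green potential of a birth and death chain\<close>

lemma nn_integral_real_plus:
  fixes g :: "'v \<Rightarrow> real"
  assumes "integrable (measure_pmf p) g" and "\<And>z. 0 \<le> g z"
  shows "(\<integral>\<^sup>+z. ennreal (g z) \<partial>p) = ennreal (measure_pmf.expectation p g)"
  using assms by (intro nn_integral_eq_integral) auto

locale bd_chain = tree V E r for V :: "'v set" and E r +
  fixes P :: "'v \<Rightarrow> 'v pmf"
  assumes kernel: "birth_death_kernel V E r P"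
begin

abbreviation "birth \<equiv> birth_rate E r P"
abbreviation "death \<equiv> death_rate E r P"

lemma rates_pos: "x \<in> V \<Longrightarrow> x \<noteq> r \<Longrightarrow> birth x > 0" "x \<in> V \<Longrightarrow> x \<noteq> r \<Longrightarrow> death x > 0"
  using kernel by (auto simp: birth_death_kernel_def)

lemma set_pmf_cases:
  assumes "x \<in> V" "z \<in> set_pmf (P x)"
  obtains "z = x" | "z \<in> V" "z \<noteq> r" "par z = x" | "x \<noteq> r" "z = par x"
proof -
  have "z = x \<or> z \<in> children V E r x \<or> x \<noteq> r \<and> z = par x"
    using assms kernel unfolding birth_death_kernel_def set_pmf_eq by force
  then show ?thesis using that unfolding children_def by auto
qed

lemma support:
  assumes "x \<in> V"
  shows "set_pmf (P x) \<subseteq> V"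
proof
  fix z assume "z \<in> set_pmf (P x)"
  with assms show "z \<in> V"
    by (cases rule: set_pmf_cases) (use assms root_path_parent(2) in auto)
qed

text \<open>A step enters or leaves the branch of \<open>y\<close> only if it crosses the
  edge between \<open>y\<close> and its parent.\<close>

lemma prob_branch:
  assumes x: "x \<in> V" and y: "y \<in> V" "y \<noteq> r"
  shows "measure (P x) {z. tree_le E r y z}
       = of_bool (tree_le E r y x) - of_bool (x = y) * death y + of_bool (x = par y) * birth y"
proof -
  have supp: "measure (P x) {z. tree_le E r y z} = measure (P x) A"
    if "\<And>z. z \<in> set_pmf (P x) \<Longrightarrow> tree_le E r y z \<longleftrightarrow> z \<in> A" for A
    using that by (intro measure_pmf.finite_measure_eq_AE) (auto simp: AE_measure_pmf_iff)
  have yp: "\<not> tree_le E r y (par y)" "par y \<noteq> y"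
    using not_tree_le_parent parent_neq y by auto
  consider "tree_le E r y x" "y \<noteq> x" | "y = x" | "\<not> tree_le E r y x" by blast
  then show ?thesis
  proof cases
    case 1
    have "tree_le E r y z" if "z \<in> set_pmf (P x)" for z
      using x that
      by (cases rule: set_pmf_cases)
        (use 1 x tree_le_parent_iff[of z y] tree_le_parent_iff[of x y] in auto)
    then have "measure (P x) {z. tree_le E r y z} = measure (P x) UNIV"
      by (intro supp) auto
    then show ?thesis using 1 yp by auto
  next
    case 2
    have "tree_le E r y z \<longleftrightarrow> z \<in> UNIV - {par x}" if "z \<in> set_pmf (P x)" for z
      using x that
      by (cases rule: set_pmf_cases)
        (use 2 y yp tree_le_parent_iff[of z y] in auto)
    then have "measure (P x) {z. tree_le E r y z} = measure (P x) (UNIV - {par x})"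
      by (rule supp)
    also have "\<dots> = 1 - death x"
      using measure_pmf.prob_compl[of "{par x}" "P x"]
      by (simp add: death_rate_def measure_pmf_single)
    finally show ?thesis using 2 yp x by auto
  next
    case 3
    show ?thesis
    proof (cases "x = par y")
      case True
      have "tree_le E r y z \<longleftrightarrow> z \<in> {y}" if "z \<in> set_pmf (P x)" for z
        using x that
        by (cases rule: set_pmf_cases)
          (use 3 x y yp tree_le_parent_iff[of z y] tree_le_parent_iff[of x y] True in auto)
      then have "measure (P x) {z. tree_le E r y z} = measure (P x) {y}"
        by (rule supp)
      then show ?thesis using 3 True yp by (simp add: birth_rate_def measure_pmf_single)
    next
      case False
      have "tree_le E r y z \<longleftrightarrow> z \<in> {}" if "z \<in> set_pmf (P x)" for z
        using x that
        by (cases rule: set_pmf_cases)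
          (use 3 x tree_le_parent_iff[of z y] tree_le_parent_iff[of x y] False in auto)
      then have "measure (P x) {z. tree_le E r y z} = measure (P x) {}"
        by (rule supp)
      then show ?thesis using 3 False y by auto
    qed
  qed
qed

text \<open>The reversible measure, normalised to have mass 1 at the root.\<close>

definition rho :: "'v \<Rightarrow> real" where
  "rho x = (\<Prod>y\<in>ell E r x. birth y / death y)"

text \<open>In the electrical network of the reversible chain, \<open>rho y * death y\<close> is the conductance of
  the edge from \<open>y\<close> to its parent.\<close>

definition resistance :: "'v \<Rightarrow> real" where
  "resistance y = 1 / (rho y * death y)"

text \<open>The voltage at \<open>x\<close> when a unit current enters at \<open>z\<close> and leaves at the grounded root.\<close>

definition green :: "'v \<Rightarrow> 'v \<Rightarrow> real" where
  "green z x = sum resistance (ell E r z \<inter> ell E r x)"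

lemma rho_root [simp]: "rho r = 1"
  by (simp add: rho_def)

lemma not_in_ell_parent: "x \<in> V \<Longrightarrow> x \<noteq> r \<Longrightarrow> x \<notin> ell E r (par x)"
  using ell_eq root_path_parent(2) not_tree_le_parent by auto

lemma rho_parent: "x \<in> V \<Longrightarrow> x \<noteq> r \<Longrightarrow> rho x = birth x / death x * rho (par x)"
  unfolding rho_def by (simp add: ell_parent not_in_ell_parent)

lemma rho_pos: "x \<in> V \<Longrightarrow> rho x > 0"
  unfolding rho_def using ell_subset rates_pos by (intro prod_pos divide_pos_pos) blast+

lemma resistance_pos: "y \<in> V \<Longrightarrow> y \<noteq> r \<Longrightarrow> resistance y > 0"
  by (simp add: resistance_def rho_pos rates_pos)

text \<open>In this form the potential is a combination of indicators of branches, whose means under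
  one step are given by \<open>prob_branch\<close>.\<close>

lemma green_alt:
  assumes "z \<in> V" "x \<in> V"
  shows "green z x = (\<Sum>y\<in>ell E r z. resistance y * indicator {x. tree_le E r y x} x)"
proof -
  have "green z x = (\<Sum>y\<in>ell E r z. if y \<in> ell E r x then resistance y else 0)"
    by (simp add: green_def sum.inter_restrict)
  also have "\<dots> = (\<Sum>y\<in>ell E r z. resistance y * indicator {x. tree_le E r y x} x)"
    using assms by (intro sum.cong) (auto simp: ell_eq)
  finally show ?thesis .
qed

lemma green_nonneg: "z \<in> V \<Longrightarrow> green z x \<ge> 0"
  unfolding green_def using ell_subset[of z] resistance_pos
  by (intro sum_nonneg) (auto intro!: less_imp_le)

lemma expectation_cong_support:
  assumes "x \<in> V" and "\<And>z. z \<in> V \<Longrightarrow> f z = (g z :: real)"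
  shows "measure_pmf.expectation (P x) f = measure_pmf.expectation (P x) g"
    and "integrable (P x) f \<longleftrightarrow> integrable (P x) g"
proof -
  have "AE z in P x. f z = g z"
    using assms support[of x] by (auto simp: AE_measure_pmf_iff)
  then show "measure_pmf.expectation (P x) f = measure_pmf.expectation (P x) g"
    "integrable (P x) f \<longleftrightarrow> integrable (P x) g"
    by (rule integral_cong_AE[rotated 2], rule_tac [3] integrable_cong_AE) auto
qed

lemma integrable_branch_sum:
  "integrable (measure_pmf p) (\<lambda>x. \<Sum>y\<in>ell E r z. c y * indicator (A y) x :: real)"
  by (intro Bochner_Integration.integrable_sum integrable_mult_right
      measure_pmf.integrable_const_bound[where B = 1]) (auto simp: indicator_def)

lemma integrable_green [simp]:
  assumes "z \<in> V" "x \<in> V"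
  shows "integrable (P x) (green z)"
  by (rule expectation_cong_support(2)[THEN iffD2, OF assms(2) green_alt integrable_branch_sum])
    (use assms in auto)

text \<open>By induction on \<open>z\<close>, moving away from the root.  By reversibility the edge from \<open>z\<close> to its
  parent contributes \<open>1/rho z\<close> at \<open>z\<close> and \<open>- 1/rho (par z)\<close> at the parent, so that the
  contributions telescope along the path and only those of \<open>z\<close> and of the root remain.\<close>

lemma expectation_green:
  assumes "z \<in> V" "x \<in> V"
  shows "measure_pmf.expectation (P x) (green z) = green z x - of_bool (x = z) / rho z + of_bool (x = r)"
proof -
  have *: "measure_pmf.expectation (P x) (green z)
      = (\<Sum>y\<in>ell E r z. resistance y * measure (P x) {u. tree_le E r y u})" if "z \<in> V" for z
  proof -
    have "measure_pmf.expectation (P x) (green z)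
        = measure_pmf.expectation (P x) (\<lambda>u. \<Sum>y\<in>ell E r z. resistance y * indicator {u. tree_le E r y u} u)"
      using green_alt[OF that] by (intro expectation_cong_support(1)[OF assms(2)])
    then show ?thesis by (subst (asm) Bochner_Integration.integral_sum)
      (simp_all add: measure_pmf.emeasure_eq_measure less_top[symmetric])
  qed
  show ?thesis
    using assms(1)
  proof (induction rule: tree_induct)
    case root
    show ?case by (simp add: * green_def)
  next
    case (parent z)
    have pz: "par z \<in> V" using parent root_path_parent by simp
    have pos: "death z \<noteq> 0" "birth z \<noteq> 0" "rho z \<noteq> 0" "rho (par z) \<noteq> 0"
      using rates_pos[of z] rho_pos[of z] rho_pos[OF pz] parent.hyps by auto
    have res: "resistance z * death z = 1 / rho z"
      using pos by (simp add: resistance_def)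
    have "rho z * death z = birth z * rho (par z)"
      using pos parent.hyps by (simp add: rho_parent)
    then have res': "resistance z * birth z = 1 / rho (par z)"
      using pos by (simp add: resistance_def)
    have "measure_pmf.expectation (P x) (green z)
        = measure_pmf.expectation (P x) (green (par z)) + resistance z * measure (P x) {u. tree_le E r z u}"
      using parent pz by (simp add: * ell_parent not_in_ell_parent)
    also have "\<dots> = (green (par z) x + resistance z * of_bool (tree_le E r z x))
        - of_bool (x = z) / rho z + of_bool (x = r)"
      unfolding parent.IH prob_branch[OF assms(2) parent.hyps] distrib_left right_diff_distrib
        mult.left_commute[of "resistance z"] res res'
      by simp
    also have "green (par z) x + resistance z * of_bool (tree_le E r z x) = green z x"
    proof -
      have "green z x = resistance z * indicator {u. tree_le E r z u} x + green (par z) x"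
        unfolding green_alt[OF parent.hyps(1) assms(2)] green_alt[OF pz assms(2)]
          ell_parent[OF parent.hyps]
        by (subst sum.insert) (use not_in_ell_parent parent.hyps in auto)
      then show ?thesis by (simp add: indicator_def)
    qed
    finally show ?case .
  qed
qed

end


section \<open>Mean hitting times in terms of branch masses\<close>

locale bd_process = bd_chain V E r P for V :: "'v set" and E r P +
  fixes M :: "'v \<Rightarrow> 'w measure" and X :: "'v \<Rightarrow> nat \<Rightarrow> 'w \<Rightarrow> 'v"
  assumes chains: "\<And>x. x \<in> V \<Longrightarrow> markov_chain_from (M x) V P x (X x)"
begin

lemma rho_summable: "rho summable_on V"
  using kernel unfolding birth_death_kernel_def rho_def[abs_def]
  by (cases "finite V") auto

lemma countable_V: "countable V"
proof -
  have "{x \<in> V. rho x \<noteq> 0} = V" using rho_pos by force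
  then show ?thesis using summable_countable_real[OF rho_summable] by simp
qed

lemma countable_chain: "x \<in> V \<Longrightarrow> countable_chain (M x) V P x (X x)"
  using chains[of x] countable_V support
  by (simp add: countable_chain_def countable_chain_axioms_def markov_chain_from_def)

definition weight :: "'v \<Rightarrow> real" where
  "weight y = infsum rho (branch V E r y)"

lemma branch_subset: "branch V E r y \<subseteq> V"
  by (auto simp: branch_def)

lemma rho_summable_branch: "rho summable_on branch V E r y"
  using rho_summable branch_subset by (rule summable_on_subset_banach)

lemma weight_nonneg: "0 \<le> weight y"
  unfolding weight_def using branch_subset rho_pos by (intro infsum_nonneg) (auto intro: less_imp_le)

lemma nn_integral_branch:
  "(\<integral>\<^sup>+z. ennreal (rho z) * indicator (branch V E r y) z \<partial>count_space V) = ennreal (weight y)"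
proof -
  let ?B = "branch V E r y"
  have nn: "0 \<le> rho z" if "z \<in> ?B" for z
    using that branch_subset rho_pos by (auto intro: less_imp_le)
  have abs: "Infinite_Set_Sum.abs_summable_on rho ?B"
    by (rule abs_summable_equivalent[THEN iffD1,
        OF summable_on_iff_abs_summable_on_real[THEN iffD1, OF rho_summable_branch]])
  have "(\<integral>\<^sup>+z. ennreal (rho z) * indicator ?B z \<partial>count_space V)
      = (\<integral>\<^sup>+z. ennreal (rho z) * indicator ?B z * indicator V z \<partial>count_space UNIV)"
    by (rule nn_integral_count_space_indicator) simp
  also have "\<dots> = (\<integral>\<^sup>+z. ennreal (rho z) * indicator ?B z \<partial>count_space UNIV)"
    using branch_subset by (intro nn_integral_cong) (auto simp: indicator_def)
  also have "\<dots> = (\<integral>\<^sup>+z. ennreal (rho z) \<partial>count_space ?B)"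
    by (rule nn_integral_count_space_indicator[symmetric]) simp
  also have "\<dots> = ennreal (infsetsum rho ?B)"
    using abs nn by (intro nn_integral_conv_infsetsum)
  also have "infsetsum rho ?B = weight y"
    unfolding weight_def using abs by (rule infsetsum_infsum)
  finally show ?thesis .
qed

text \<open>The comparison function is \<open>f x = \<Sum>z. rho z * green z x\<close>, which satisfies \<open>f = 1 + P f\<close>
  away from the root.  Its value at \<open>a\<close> is rearranged by collecting, for each edge on the path
  from \<open>a\<close>, the mass of the branch behind that edge.\<close>

lemma mean_hitting_root_le:
  assumes a: "a \<in> V"
  shows "mean_hitting_time M X a r \<le> ennreal (\<Sum>y\<in>ell E r a. resistance y * weight y)"
proof -
  interpret countable_chain "M a" V P a "X a" using countable_chain[OF a] .
  define f where "f x = (\<integral>\<^sup>+z. ennreal (rho z) * ennreal (green z x) \<partial>count_space V)" for x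
  have "1 + (\<integral>\<^sup>+u. f u \<partial>P x) \<le> f x" if x: "x \<in> V" "x \<noteq> r" for x
  proof -
    interpret PS: pair_sigma_finite "count_space V" "measure_pmf (P x)"
      using countable_V sigma_finite_measure_count_space_countable measure_pmf.sigma_finite_measure_axioms
      by (auto simp: pair_sigma_finite_def)
    have "(\<lambda>(z, u). ennreal (rho z) * ennreal (green z u))
        \<in> borel_measurable (count_space V \<Otimes>\<^sub>M measure_pmf (P x))"
      by (intro measurable_pair_measure_countable1 countable_V) simp
    from PS.Fubini'[OF this]
    have "(\<integral>\<^sup>+u. f u \<partial>P x) = (\<integral>\<^sup>+z. (\<integral>\<^sup>+u. ennreal (rho z) * ennreal (green z u) \<partial>P x) \<partial>count_space V)"
      unfolding f_def by simp
    also have "\<dots> = (\<integral>\<^sup>+z. ennreal (rho z * (green z x - of_bool (x = z) / rho z)) \<partial>count_space V)"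
    proof (rule nn_integral_cong)
      fix z assume "z \<in> space (count_space V)"
      then have z: "z \<in> V" by simp
      have "(\<integral>\<^sup>+u. ennreal (rho z) * ennreal (green z u) \<partial>P x)
          = ennreal (rho z) * ennreal (measure_pmf.expectation (P x) (green z))"
        using z x by (simp add: nn_integral_cmult nn_integral_real_plus green_nonneg)
      also have "\<dots> = ennreal (rho z * measure_pmf.expectation (P x) (green z))"
        using z rho_pos by (intro ennreal_mult'[symmetric]) (simp add: less_imp_le)
      finally show "(\<integral>\<^sup>+u. ennreal (rho z) * ennreal (green z u) \<partial>P x)
          = ennreal (rho z * (green z x - of_bool (x = z) / rho z))"
        using z x by (simp add: expectation_green)
    qed
    finally have Pf: "(\<integral>\<^sup>+u. f u \<partial>P x)
      = (\<integral>\<^sup>+z. ennreal (rho z * (green z x - of_bool (x = z) / rho z)) \<partial>count_space V)" .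
    have "1 = (\<integral>\<^sup>+z. indicator {x} z \<partial>count_space V)"
      using x by simp
    then have "1 + (\<integral>\<^sup>+u. f u \<partial>P x) = (\<integral>\<^sup>+z. indicator {x} z
        + ennreal (rho z * (green z x - of_bool (x = z) / rho z)) \<partial>count_space V)"
      unfolding Pf by (simp add: nn_integral_add)
    also have "\<dots> = f x"
      unfolding f_def
    proof (rule nn_integral_cong)
      fix z assume "z \<in> space (count_space V)"
      then have z: "z \<in> V" by simp
      have "0 \<le> measure_pmf.expectation (P x) (green z)"
        using z by (intro Bochner_Integration.integral_nonneg green_nonneg)
      then have nn: "0 \<le> green z x - of_bool (x = z) / rho z"
        using x z by (simp add: expectation_green)
      have "indicator {x} z + ennreal (rho z * (green z x - of_bool (x = z) / rho z))
          = ennreal (of_bool (x = z)) + ennreal (rho z * (green z x - of_bool (x = z) / rho z))"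
        by (simp add: indicator_def)
      also have "\<dots> = ennreal (of_bool (x = z) + rho z * (green z x - of_bool (x = z) / rho z))"
        using nn rho_pos[OF z] by (intro ennreal_plus[symmetric]) auto
      also have "of_bool (x = z) + rho z * (green z x - of_bool (x = z) / rho z) = rho z * green z x"
        using rho_pos[OF z] by (simp add: field_simps)
      also have "ennreal (rho z * green z x) = ennreal (rho z) * ennreal (green z x)"
        using rho_pos[OF z] by (intro ennreal_mult') (simp add: less_imp_le)
      finally show "indicator {x} z + ennreal (rho z * (green z x - of_bool (x = z) / rho z))
          = ennreal (rho z) * ennreal (green z x)" .
    qed
    finally show ?thesis by simp
  qed
  then have "mean_hitting_time M X a r \<le> f a"
    unfolding mean_hitting_time_def by (rule expected_hitting_time_le)
  also have "f a = (\<integral>\<^sup>+z. (\<Sum>y\<in>ell E r a. ennreal (resistance y) *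
      (ennreal (rho z) * indicator (branch V E r y) z)) \<partial>count_space V)"
    unfolding f_def
  proof (rule nn_integral_cong)
    fix z assume "z \<in> space (count_space V)"
    then have z: "z \<in> V" by simp
    have res: "resistance y \<ge> 0" if "y \<in> ell E r a" for y
      using that ell_subset[OF a] resistance_pos[of y] by (auto intro: less_imp_le)
    have "green z a = green a z" by (simp add: green_def Int_commute)
    then have "ennreal (green z a) = (\<Sum>y\<in>ell E r a. ennreal (resistance y * indicator (branch V E r y) z))"
      using res z a by (subst sum_ennreal) (auto simp: green_alt branch_def indicator_def)
    then show "ennreal (rho z) * ennreal (green z a) = (\<Sum>y\<in>ell E r a. ennreal (resistance y) *
      (ennreal (rho z) * indicator (branch V E r y) z))"
      by (simp add: sum_distrib_left)
        (auto simp: indicator_def mult_ac intro!: sum.cong)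
  qed
  also have "\<dots> = (\<Sum>y\<in>ell E r a. ennreal (resistance y) * ennreal (weight y))"
    by (simp add: nn_integral_sum nn_integral_cmult nn_integral_branch)
  also have "\<dots> = (\<Sum>y\<in>ell E r a. ennreal (resistance y * weight y))"
    by (intro sum.cong) (simp_all add: ennreal_mult'' weight_nonneg)
  also have "\<dots> = ennreal (\<Sum>y\<in>ell E r a. resistance y * weight y)"
    using ell_subset[OF a] resistance_pos weight_nonneg
    by (intro sum_ennreal mult_nonneg_nonneg) (auto intro!: less_imp_le)
  finally show ?thesis .
qed

lemma le_mean_hitting_time:
  fixes g :: "'v \<Rightarrow> real"
  assumes x: "x \<in> V" and nn: "\<And>u. 0 \<le> g u" and bdd: "\<And>u. g u \<le> C" and g0: "g y = 0"
    and int: "\<And>u. u \<in> V \<Longrightarrow> integrable (P u) g"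
    and g: "\<And>u. u \<in> V \<Longrightarrow> u \<noteq> y \<Longrightarrow> g u \<le> 1 + measure_pmf.expectation (P u) g"
  shows "ennreal (g x) \<le> mean_hitting_time M X x y"
proof -
  interpret countable_chain "M x" V P x "X x" using countable_chain[OF x] .
  show ?thesis unfolding mean_hitting_time_def
  proof (rule le_expected_hitting_time[where f = "\<lambda>u. ennreal (g u)" and C = "ennreal C"])
    fix u assume u: "u \<in> V" "u \<noteq> y"
    have "ennreal (g u) \<le> ennreal (1 + measure_pmf.expectation (P u) g)"
      using g[OF u] by (rule ennreal_leI)
    also have "\<dots> = 1 + (\<integral>\<^sup>+z. ennreal (g z) \<partial>P u)"
      using int[OF u(1)] nn by (simp add: nn_integral_real_plus)
    finally show "ennreal (g u) \<le> 1 + (\<integral>\<^sup>+z. ennreal (g z) \<partial>P u)" .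
  qed (use bdd g0 in \<open>auto intro: ennreal_leI\<close>)
qed

lemma ell_mono: "tree_le E r y z \<Longrightarrow> z \<in> V \<Longrightarrow> ell E r y \<subseteq> ell E r z"
  using tree_le_in[of y z] tree_le_trans[of y z] by (auto simp: ell_eq)

lemma green_diff:
  assumes "ell E r y \<subseteq> ell E r z"
  shows "green z x - green y x = sum resistance ((ell E r z - ell E r y) \<inter> ell E r x)"
proof -
  have "(ell E r z - ell E r y) \<inter> ell E r x = ell E r z \<inter> ell E r x - ell E r y \<inter> ell E r x" by blast
  then show ?thesis
    using sum_diff[of "ell E r z \<inter> ell E r x" "ell E r y \<inter> ell E r x" resistance]
      Int_mono[OF assms subset_refl]
    unfolding green_def by simp
qed

lemma sum_resistance_mono:
  "A \<subseteq> B \<Longrightarrow> B \<subseteq> ell E r z \<Longrightarrow> z \<in> V \<Longrightarrow> sum resistance A \<le> sum resistance B"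
  using ell_subset[of z] resistance_pos finite_subset[of B "ell E r z"]
  by (intro sum_mono2) (auto intro!: less_imp_le)

text \<open>The comparison function is the sum over \<open>z\<close> in \<open>F\<close> of \<open>rho z * (green z x - green (par b) x)\<close>,
  with a current \<open>rho z\<close> entering at each \<open>z\<close> in \<open>F\<close> and leaving at the parent of \<open>b\<close>.  Restricting
  to a finite part \<open>F\<close> of the branch keeps it bounded, as the lower comparison requires; the
  mass of the whole branch is then the supremum over \<open>F\<close>.\<close>

lemma weight_le:
  assumes b: "b \<in> V" "b \<noteq> r" and K: "ennreal (death b) * mean_hitting_time M X b (par b) \<le> ennreal K"
    and K0: "0 \<le> K"
  shows "weight b \<le> K * rho b"
  unfolding weight_def
proof (rule infsum_le_finite_sums[OF rho_summable_branch])
  fix F assume F: "finite F" "F \<subseteq> branch V E r b"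
  have pb: "par b \<in> V" using root_path_parent b by simp
  have FV: "z \<in> V" "tree_le E r b z" if "z \<in> F" for z using that F by (auto simp: branch_def)
  have sub: "ell E r (par b) \<subseteq> ell E r z" "b \<in> ell E r z" if "z \<in> F" for z
    using ell_mono[OF FV(2,1)[OF that]] ell_parent[OF b] by auto
  define g where "g x = (\<Sum>z\<in>F. rho z * (green z x - green (par b) x))" for x
  have g1: "0 \<le> green z x - green (par b) x" 
    "green z x - green (par b) x \<le> sum resistance (ell E r z)" if "z \<in> F" for z x
    unfolding green_diff[OF sub(1)[OF that]]
    using FV(1)[OF that] sum_resistance_mono[of "{}" _ z] sum_resistance_mono[of _ "ell E r z" z]
    by (auto simp: subset_iff)
  have rp: "0 \<le> rho z" if "z \<in> F" for z using rho_pos[OF FV(1)[OF that]] by simp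
  have "ennreal (g b) \<le> mean_hitting_time M X b (par b)"
  proof (rule le_mean_hitting_time[where C = "\<Sum>z\<in>F. rho z * sum resistance (ell E r z)"])
    show "0 \<le> g u" for u unfolding g_def using g1 rp by (intro sum_nonneg mult_nonneg_nonneg)
    show "g u \<le> (\<Sum>z\<in>F. rho z * sum resistance (ell E r z))" for u
      unfolding g_def using g1 rp by (intro sum_mono mult_left_mono)
    have "green z (par b) = green (par b) (par b)" if "z \<in> F" for z
      using sub(1)[OF that] unfolding green_def by (simp add: Int_absorb1)
    then show "g (par b) = 0" unfolding g_def by simp
    show "integrable (P u) g" if "u \<in> V" for u
      unfolding g_def[abs_def] using that FV pb
      by (intro Bochner_Integration.integrable_sum integrable_mult_right Bochner_Integration.integrable_diff) auto
    fix u assume u: "u \<in> V" "u \<noteq> par b"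
    have "measure_pmf.expectation (P u) g
        = (\<Sum>z\<in>F. rho z * (measure_pmf.expectation (P u) (green z) - measure_pmf.expectation (P u) (green (par b))))"
      unfolding g_def[abs_def] using u FV pb by (simp add: Bochner_Integration.integral_sum)
    also have "\<dots> = (\<Sum>z\<in>F. rho z * (green z u - green (par b) u) - of_bool (u = z))"
      using u FV pb rho_pos[OF u(1)] by (intro sum.cong) (auto simp: expectation_green field_simps)
    also have "\<dots> = g u - (\<Sum>z\<in>F. of_bool (u = z))"
      by (simp add: g_def sum_subtractf)
    finally have "measure_pmf.expectation (P u) g = g u - (\<Sum>z\<in>F. of_bool (u = z))" .
    moreover have "(\<Sum>z\<in>F. of_bool (u = z)) \<le> (1::real)"
      using F(1) by (cases "u \<in> F") (auto simp: of_bool_def sum.delta)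
    ultimately show "g u \<le> 1 + measure_pmf.expectation (P u) g" by linarith
  qed (rule b)
  moreover have "green z b - green (par b) b = resistance b" if "z \<in> F" for z
  proof -
    have "(ell E r z - ell E r (par b)) \<inter> ell E r b = {b}"
      using sub[OF that] not_in_ell_parent[OF b] unfolding ell_parent[OF b] by auto
    then show ?thesis unfolding green_diff[OF sub(1)[OF that]] by simp
  qed
  then have "g b = sum rho F * resistance b" unfolding g_def by (simp add: sum_distrib_right)
  ultimately have "ennreal (death b) * ennreal (sum rho F * resistance b) \<le> ennreal K"
    using K by (metis mult_left_mono order_trans zero_le)
  moreover have d: "death b > 0" "rho b > 0" using rates_pos rho_pos b by auto
  ultimately have "ennreal (death b * (sum rho F * resistance b)) \<le> ennreal K"
    by (simp add: ennreal_mult')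
  then have "death b * (sum rho F * resistance b) \<le> K" using K0 by (simp add: ennreal_le_iff)
  then show "sum rho F \<le> K * rho b"
    using d by (simp add: resistance_def field_simps)
qed

lemma rho_le_weight:
  assumes b: "b \<in> V"
  shows "rho b \<le> weight b"
proof -
  have "infsum rho {b} \<le> weight b" unfolding weight_def
    using b rho_pos branch_subset[of b] rho_summable_branch
    by (intro infsum_mono2) (auto simp: branch_def intro: less_imp_le)
  then show ?thesis by simp
qed

lemma weight_le_weight_parent:
  assumes b: "b \<in> V" "b \<noteq> r"
  shows "weight b \<le> weight (par b)"
proof -
  have nn: "0 \<le> rho z" if "z \<in> V" for z using rho_pos[OF that] by simp
  have "branch V E r b \<subseteq> branch V E r (par b)"
    using b tree_le_trans[of b _ "par b"] tree_le_parent_iff[OF b, of "par b"] root_path_parent[OF b]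
    by (auto simp: branch_def)
  then show ?thesis unfolding weight_def
    using nn branch_subset rho_summable_branch by (intro infsum_mono2) auto
qed

text \<open>Here a current \<open>rho z\<close> enters at each point \<open>z \<noteq> a\<close> of the path from \<open>a\<close> to the root, and
  leaves at \<open>a\<close>.  The constant in each summand makes the function vanish at \<open>a\<close>.  As no
  current enters off the path, the function is constant on the branches that leave the path,
  hence bounded.\<close>

lemma le_mean_hitting_from_root:
  assumes a: "a \<in> V"
  shows "ennreal (\<Sum>z\<in>insert r (ell E r a) - {a}. rho z * sum resistance (ell E r a - ell E r z))
     \<le> mean_hitting_time M X r a"
proof -
  define S where "S = insert r (ell E r a) - {a}"
  have SV: "z \<in> V" "z \<noteq> a" if "z \<in> S" for z using that ell_subset[OF a] by (auto simp: S_def)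
  have sub: "ell E r z \<subseteq> ell E r a" if "z \<in> S" for z
    using that a ell_mono[of z a] by (auto simp: S_def ell_eq)
  define g where "g x = (\<Sum>z\<in>S. rho z * (sum resistance (ell E r a - ell E r z)
      - (green a x - green z x)))" for x
  have g1: "0 \<le> sum resistance (ell E r a - ell E r z) - (green a x - green z x)"
    "sum resistance (ell E r a - ell E r z) - (green a x - green z x) \<le> sum resistance (ell E r a)"
    if "z \<in> S" for z x
    unfolding green_diff[OF sub[OF that]]
    using sum_resistance_mono[of "(ell E r a - ell E r z) \<inter> ell E r x" "ell E r a - ell E r z" a]
      sum_resistance_mono[of "{}" "(ell E r a - ell E r z) \<inter> ell E r x" a]
      sum_resistance_mono[of "ell E r a - ell E r z" "ell E r a" a] a
    by (auto simp: le_infI1)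
  have rp: "0 \<le> rho z" if "z \<in> S" for z using rho_pos[OF SV(1)[OF that]] by simp
  have "ennreal (g r) \<le> mean_hitting_time M X r a"
  proof (rule le_mean_hitting_time[where C = "\<Sum>z\<in>S. rho z * sum resistance (ell E r a)"])
    show "0 \<le> g u" for u unfolding g_def using g1 rp by (intro sum_nonneg mult_nonneg_nonneg)
    show "g u \<le> (\<Sum>z\<in>S. rho z * sum resistance (ell E r a))" for u
      unfolding g_def using g1 rp by (intro sum_mono mult_left_mono)
    have "green a a - green z a = sum resistance (ell E r a - ell E r z)" if "z \<in> S" for z
      unfolding green_diff[OF sub[OF that]] by (simp add: Int_absorb2)
    then show "g a = 0" unfolding g_def by simp
    show "integrable (P u) g" if "u \<in> V" for u
      unfolding g_def[abs_def] using that SV a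
      by (intro Bochner_Integration.integrable_sum integrable_mult_right Bochner_Integration.integrable_diff) auto
    fix u assume u: "u \<in> V" "u \<noteq> a"
    have "measure_pmf.expectation (P u) g
        = (\<Sum>z\<in>S. rho z * (sum resistance (ell E r a - ell E r z)
           - (measure_pmf.expectation (P u) (green a) - measure_pmf.expectation (P u) (green z))))"
      unfolding g_def[abs_def] using u SV a by (simp add: Bochner_Integration.integral_sum)
    also have "\<dots> = (\<Sum>z\<in>S. rho z * (sum resistance (ell E r a - ell E r z)
           - (green a u - green z u)) - of_bool (u = z))"
      using u SV a rho_pos[OF u(1)] by (intro sum.cong) (auto simp: expectation_green field_simps)
    also have "\<dots> = g u - (\<Sum>z\<in>S. of_bool (u = z))"
      by (simp add: g_def sum_subtractf)
    finally have "measure_pmf.expectation (P u) g = g u - (\<Sum>z\<in>S. of_bool (u = z))" .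
    moreover have "(\<Sum>z\<in>S. of_bool (u = z)) \<le> (1::real)"
      by (cases "u \<in> S") (auto simp: of_bool_def sum.delta S_def)
    ultimately show "g u \<le> 1 + measure_pmf.expectation (P u) g" by linarith
  qed simp
  moreover have "g r = (\<Sum>z\<in>S. rho z * sum resistance (ell E r a - ell E r z))"
    unfolding g_def by (simp add: green_def)
  ultimately show ?thesis by (simp add: S_def)
qed

end


section \<open>Strong drift along a path\<close>

text \<open>In the application \<open>w j\<close> is the mass of the branch of \<open>v j\<close>.  The first \<open>m\<close> terms are bounded
  one by one; each later term is compared with the mass of the \<open>m\<close> path vertices preceding \<open>j\<close>.\<close>

lemma path_sum_bound:
  fixes \<rho> \<mu> w :: "nat \<Rightarrow> real" and K k :: real and n m :: nat
  assumes \<rho>: "\<And>j. j \<le> n \<Longrightarrow> 0 < \<rho> j" and k: "0 < k" and \<mu>: "\<And>j. 1 \<le> j \<Longrightarrow> j \<le> n \<Longrightarrow> k \<le> \<mu> j"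
    and w: "\<And>j. 1 \<le> j \<Longrightarrow> j \<le> n \<Longrightarrow> w j \<le> K * \<rho> j"
    and mono: "\<And>i j. 1 \<le> i \<Longrightarrow> i \<le> j \<Longrightarrow> j \<le> n \<Longrightarrow> w j \<le> w i"
    and K: "0 \<le> K" and m: "1 \<le> m"
  shows "(\<Sum>j=1..n. w j / (\<rho> j * \<mu> j))
    \<le> m * K / k + K / m * (\<Sum>i<n. \<rho> i * (\<Sum>j=Suc i..n. 1 / (\<rho> j * \<mu> j)))"
proof -
  define c where "c j = 1 / (\<rho> j * \<mu> j)" for j
  define S where "S j = (\<Sum>i<j. \<rho> i)" for j
  have c: "0 \<le> c j" if "1 \<le> j" "j \<le> n" for j
    using \<rho>[OF that(2)] \<mu>[OF that] k by (simp add: c_def)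
  have S: "0 \<le> S j" if "j \<le> n" for j
  proof (unfold S_def, rule sum_nonneg)
    fix i assume "i \<in> {..<j}"
    then show "0 \<le> \<rho> i" using \<rho>[of i] that by simp
  qed
  have swap: "(\<Sum>i<n. \<rho> i * (\<Sum>j=Suc i..n. c j)) = (\<Sum>j=1..n. c j * S j)"
  proof -
    have "(\<Sum>i<n. \<rho> i * (\<Sum>j=Suc i..n. c j)) = (\<Sum>i=0..<n. \<Sum>j=Suc i..n. c j * \<rho> i)"
      by (simp add: sum_distrib_left mult.commute atLeast0LessThan)
    also have "\<dots> = (\<Sum>j=0..n. \<Sum>i=0..<j. c j * \<rho> i)"
      by (rule sum.nested_swap[symmetric])
    also have "\<dots> = (\<Sum>j=0..n. c j * S j)"
      by (simp add: S_def sum_distrib_left atLeast0LessThan)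
    also have "\<dots> = (\<Sum>j=1..n. c j * S j)"
      by (simp add: sum.atLeast_Suc_atMost S_def)
    finally show ?thesis .
  qed
  have term_le: "w j * c j \<le> (if j \<le> m then K / k else 0) + K / m * (c j * S j)"
    if j: "1 \<le> j" "j \<le> n" for j
  proof (cases "j \<le> m")
    case True
    have "w j * c j \<le> K * \<rho> j * c j" using w[OF j] c[OF j] by (rule mult_right_mono)
    also have "\<dots> = K / \<mu> j" using \<rho>[OF j(2)] by (simp add: c_def)
    also have "\<dots> \<le> K / k" using \<mu>[OF j] k K by (intro divide_left_mono) auto
    finally have "w j * c j \<le> K / k" .
    moreover have "0 \<le> K / m * (c j * S j)" using c[OF j] S[OF j(2)] K by simp
    ultimately show ?thesis using True by simp
  next
    case False
    \<comment> \<open>Since \<open>j > m\<close>, the window stays away from the root, where \<open>w i \<le> K * \<rho> i\<close> is not assumed.\<close>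
    have "m * w j = (\<Sum>i\<in>{j-m..<j}. w j)" using False by simp
    also have "\<dots> \<le> (\<Sum>i\<in>{j-m..<j}. K * \<rho> i)"
    proof (rule sum_mono)
      fix i assume i: "i \<in> {j-m..<j}"
      then have "w j \<le> w i" using False j by (intro mono) auto
      also have "\<dots> \<le> K * \<rho> i" using i False j by (intro w) auto
      finally show "w j \<le> K * \<rho> i" .
    qed
    also have "\<dots> = K * (\<Sum>i\<in>{j-m..<j}. \<rho> i)" by (simp add: sum_distrib_left)
    also have "\<dots> \<le> K * S j"
    proof -
      have "0 \<le> \<rho> i" if "i < j" for i using \<rho>[of i] that j by simp
      then show ?thesis
        unfolding S_def using K by (intro mult_left_mono sum_mono2) auto
    qed
    finally have "w j \<le> K / m * S j" using m by (simp add: field_simps)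
    then have "w j * c j \<le> K / m * S j * c j" using c[OF j] by (rule mult_right_mono)
    then show ?thesis using False by (simp add: mult_ac)
  qed
  have "(\<Sum>j=1..n. w j / (\<rho> j * \<mu> j)) = (\<Sum>j=1..n. w j * c j)" by (simp add: c_def)
  also have "\<dots> \<le> (\<Sum>j=1..n. (if j \<le> m then K / k else 0) + K / m * (c j * S j))"
    using term_le by (intro sum_mono) auto
  also have "\<dots> = (\<Sum>j=1..n. if j \<le> m then K / k else 0) + K / m * (\<Sum>j=1..n. c j * S j)"
    by (simp add: sum.distrib sum_distrib_left)
  also have "(\<Sum>j=1..n. if j \<le> m then K / k else 0) = card ({1..n} \<inter> {..m}) * (K / k)"
    by (simp add: sum.If_cases atMost_def)
  also have "\<dots> \<le> m * (K / k)"
  proof (intro mult_right_mono)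
    have "card ({1..n} \<inter> {..m}) \<le> card {1..m}" by (intro card_mono) auto
    then show "real (card ({1..n} \<inter> {..m})) \<le> real m" by simp
  qed (use K k in simp)
  finally have "(\<Sum>j=1..n. w j / (\<rho> j * \<mu> j)) \<le> m * (K / k) + K / m * (\<Sum>j=1..n. c j * S j)"
    by simp
  then show ?thesis unfolding swap[symmetric] by (simp add: c_def)
qed

context bd_process
begin

text \<open>The quantitative form of the limit statement: smallness of \<open>K\<^sup>2/A\<close>, at a level that depends
  on \<open>C\<close>, makes the ratio of the mean hitting times at most \<open>2/C\<close>.\<close>

lemma hitting_ratio_le:
  fixes v :: "nat \<Rightarrow> 'v" and n :: nat
  assumes n: "1 \<le> n" and r: "v 0 = r" and inj: "inj v"
    and vV: "\<And>k. k \<le> n \<Longrightarrow> v k \<in> V"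
    and vp: "\<And>k. 1 \<le> k \<Longrightarrow> k \<le> n \<Longrightarrow> par (v k) = v (k - 1)"
    and k: "0 < k" and death: "\<And>b. b \<in> branch V E r (alpha E r (v n)) \<Longrightarrow> k \<le> death b"
    and C: "0 < C"
    and small: "(SD_sup V E r P M X (v n))\<^sup>2 / mean_hitting_time M X (v n) r
      < ennreal (k / (2 * (C + 1)))"
  shows "mean_hitting_time M X (v n) r / mean_hitting_time M X r (v n) \<le> ennreal (2 / C)"
proof -
  let ?A = "mean_hitting_time M X (v n) r" and ?B = "mean_hitting_time M X r (v n)"
  let ?S = "SD_sup V E r P M X (v n)"
  have vr: "v j \<noteq> r" if "1 \<le> j" for j using that r inj by (auto simp: inj_def)
  have ell: "ell E r (v j) = v ` {1..j}" if "j \<le> n" for j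
    using that
  proof (induction j)
    case 0
    then show ?case by (simp add: r)
  next
    case (Suc j)
    then have "ell E r (v (Suc j)) = insert (v (Suc j)) (ell E r (v j))"
      using vV[of "Suc j"] vr[of "Suc j"] vp[of "Suc j"] by (simp add: ell_parent)
    then show ?case using Suc by (simp add: atLeastAtMostSuc_conv)
  qed
  have depth: "depth E r (v j) = j" if "j \<le> n" for j
    using that
  proof (induction j)
    case 0
    then show ?case by (simp add: r)
  next
    case (Suc j)
    then show ?case using vV[of "Suc j"] vr[of "Suc j"] vp[of "Suc j"] by (simp add: depth_parent)
  qed
  have "(par ^^ j) (v n) = v (n - j)" if "j \<le> n" for j
    using that by (induction j) (auto simp: vp)
  then have alpha: "alpha E r (v n) = v 1"
    using n by (simp add: alpha_def depth)
  have in_branch: "v j \<in> branch V E r (v 1)" if "1 \<le> j" "j \<le> n" for j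
  proof -
    have "v 1 \<in> ell E r (v j)" using that by (simp add: ell)
    then show ?thesis using that vV by (simp add: branch_def ell_eq)
  qed
  note A_le = mean_hitting_root_le[OF vV[of n], simplified]
  have "?A < \<top>" using A_le le_less_trans ennreal_less_top by blast
  then obtain A where A: "?A = ennreal A" "0 \<le> A" by (cases ?A) auto
  \<comment> \<open>This needs the finiteness of \<open>?A\<close>, since \<open>\<top> / \<top> = 0\<close> in the extended nonnegative reals.\<close>
  have "?S \<noteq> \<top>"
  proof
    assume "?S = \<top>"
    then show False using small A by (simp add: power2_eq_square ennreal_top_divide)
  qed
  then obtain K where K: "?S = ennreal K" "0 \<le> K" by (cases ?S) auto
  have rho: "0 < rho (v j)" if "j \<le> n" for j using rho_pos[OF vV[OF that]] .
  have w: "weight (v j) \<le> K * rho (v j)" if j: "1 \<le> j" "j \<le> n" for j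
  proof (rule weight_le[OF vV[OF j(2)] vr[OF j(1)] _ K(2)])
    show "ennreal (death (v j)) * mean_hitting_time M X (v j) (par (v j)) \<le> ennreal K"
      unfolding K(1)[symmetric] SD_sup_def alpha using in_branch[OF j] by (rule SUP_upper)
  qed
  have "rho (v 1) \<le> K * rho (v 1)"
    using rho_le_weight[OF vV, of 1] w[of 1] n by simp
  then have K1: "1 \<le> K" using rho[of 1] n by simp
  have mono: "weight (v j) \<le> weight (v i)" if "1 \<le> i" "i \<le> j" "j \<le> n" for i j
    using that(2,1,3)
  proof (induction rule: dec_induct)
    case (step j)
    then have "weight (v (Suc j)) \<le> weight (v j)"
      using weight_le_weight_parent[OF vV vr, of "Suc j"] vp[of "Suc j"] by simp
    then show ?case using step by simp
  qed simp
  have "A \<noteq> 0"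
  proof
    assume "A = 0"
    then show False using small A K K1 by (simp add: ennreal_divide_zero)
  qed
  then have A0: "0 < A" using A by simp
  \<comment> \<open>The length of the window: it makes \<open>K / m \<le> 1 / C\<close>, while \<open>m * K\<close> is still of order \<open>K\<^sup>2\<close>
    because \<open>1 \<le> K\<close>.\<close>
  define m where "m = nat \<lceil>C * K\<rceil>"
  have "0 < C * K" using C K1 by simp
  then have m: "C * K \<le> m" "m \<le> C * K + 1"
    using ceiling_correct[of "C * K"] by (auto simp: m_def)
  then have m1: "1 \<le> m" using \<open>0 < C * K\<close> by (cases m) auto
  define B where "B = (\<Sum>i<n. rho (v i) * (\<Sum>j=Suc i..n. 1 / (rho (v j) * death (v j))))"
  have "A \<le> (\<Sum>j=1..n. weight (v j) / (rho (v j) * death (v j)))"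
  proof -
    have "ennreal A \<le> ennreal (\<Sum>j=1..n. weight (v j) / (rho (v j) * death (v j)))"
      using A_le unfolding A ell[OF order_refl]
      by (simp add: sum.reindex inj_on_subset[OF inj] resistance_def)
    moreover have "0 \<le> (\<Sum>j=1..n. weight (v j) / (rho (v j) * death (v j)))"
      using weight_nonneg rho rates_pos(2)[OF vV vr]
      by (intro sum_nonneg divide_nonneg_nonneg mult_nonneg_nonneg) (auto intro: less_imp_le)
    ultimately show ?thesis by (simp add: ennreal_le_iff)
  qed
  also have "\<dots> \<le> m * K / k + K / m * B"
    unfolding B_def
  proof (rule path_sum_bound[where \<rho> = "\<lambda>j. rho (v j)" and \<mu> = "\<lambda>j. death (v j)" and w = "\<lambda>j. weight (v j)"])
    show "k \<le> death (v j)" if "1 \<le> j" "j \<le> n" for j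
      using death in_branch[OF that] by (simp add: alpha)
  qed (fact rho k w mono K(2) m1)+
  finally have AB: "A \<le> m * K / k + K / m * B" .
  have B0: "0 \<le> B"
    unfolding B_def using rho rates_pos(2)[OF vV vr]
    by (intro sum_nonneg mult_nonneg_nonneg divide_nonneg_nonneg) (auto intro: less_imp_le)
  have "K / m \<le> 1 / C" using m(1) m1 C by (simp add: field_simps)
  then have "K / m * B \<le> B / C" using B0 mult_right_mono by fastforce
  moreover have "m * K / k \<le> A / 2"
  proof -
    have "ennreal (K\<^sup>2 / A) < ennreal (k / (2 * (C + 1)))"
      using small A K A0 by (simp add: divide_ennreal ennreal_power)
    then have "K\<^sup>2 / A < k / (2 * (C + 1))" using k C by (simp add: ennreal_less_iff A)
    then have *: "(C + 1) * K\<^sup>2 / k < A / 2" using A0 k C by (simp add: field_simps)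
    have "m * K \<le> (C * K + K) * K" using m(2) K1 by (intro mult_right_mono) auto
    then have "m * K / k \<le> (C + 1) * K\<^sup>2 / k"
      using k by (simp add: divide_right_mono power2_eq_square algebra_simps)
    then show ?thesis using * by linarith
  qed
  ultimately have "A / 2 \<le> B / C" using AB by linarith
  moreover have "B * (2 / C) = 2 * (B / C)" by simp
  ultimately have AB': "A \<le> B * (2 / C)" by linarith
  have "ennreal B \<le> ?B"
  proof -
    have "insert r (ell E r (v n)) - {v n} = v ` (insert 0 {1..n} - {n})"
      unfolding ell[OF order_refl] image_set_diff[OF inj] by (simp add: r)
    also have "insert 0 {1..n} - {n} = {..<n}" using n by auto
    finally have "insert r (ell E r (v n)) - {v n} = v ` {..<n}" .
    moreover have "ell E r (v n) - ell E r (v i) = v ` {Suc i..n}" if "i < n" for i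
    proof -
      have "{1..n} - {1..i} = {Suc i..n}" by auto
      then show ?thesis
        unfolding ell[OF order_refl] ell[OF less_imp_le[OF that]] image_set_diff[OF inj, symmetric]
        by simp
    qed
    ultimately have "(\<Sum>z\<in>insert r (ell E r (v n)) - {v n}. rho z * sum resistance (ell E r (v n) - ell E r z)) = B"
      by (simp add: B_def sum.reindex[OF inj_on_subset[OF inj subset_UNIV]] resistance_def)
    then show ?thesis using le_mean_hitting_from_root[OF vV[of n]] by simp
  qed
  have "ennreal A \<le> ennreal (B * (2 / C))" using AB' by (rule ennreal_leI)
  also have "\<dots> = ennreal B * ennreal (2 / C)" using B0 C by (intro ennreal_mult) auto
  also have "\<dots> \<le> ?B * ennreal (2 / C)" using \<open>ennreal B \<le> ?B\<close> by (rule mult_right_mono) simp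
  finally have le: "ennreal A \<le> ?B * ennreal (2 / C)" .
  have "?B \<noteq> 0"
  proof
    assume "?B = 0"
    then show False using le A0 by simp
  qed
  then have "0 < ?B" by (simp add: zero_less_iff_neq_zero)
  then show ?thesis unfolding A(1) using le
    by (rule divide_le_posI_ennreal)
qed

end

theorem proposition2p3:
  fixes v :: "nat \<Rightarrow> 'v"
    and I :: "'v \<Rightarrow> 'v set"
    and E :: "'v \<Rightarrow> 'v set set"
    and P :: "'v \<Rightarrow> 'v \<Rightarrow> 'v pmf"
    and M :: "'v \<Rightarrow> 'v \<Rightarrow> 'w measure"
    and X :: "'v \<Rightarrow> 'v \<Rightarrow> nat \<Rightarrow> 'w \<Rightarrow> 'v"
  assumes path: "inj v"
    and tree: "\<And>n. n \<ge> 1 \<Longrightarrow> rooted_tree (I (v n)) (E (v n)) (v 0)"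
    and path_in: "\<And>n k. n \<ge> 1 \<Longrightarrow> k \<le> n \<Longrightarrow> v k \<in> I (v n)"
    and path_parent:
      "\<And>n k. 1 \<le> k \<Longrightarrow> k \<le> n \<Longrightarrow> parent (E (v n)) (v 0) (v k) = v (k - 1)"
    and kernel: "\<And>n. n \<ge> 1 \<Longrightarrow> birth_death_kernel (I (v n)) (E (v n)) (v 0) (P (v n))"
    and irred: "\<And>n. n \<ge> 1 \<Longrightarrow> irreducible_kernel (I (v n)) (P (v n))"
    and chain: "\<And>n x. n \<ge> 1 \<Longrightarrow> x \<in> I (v n) \<Longrightarrow>
      markov_chain_from (M (v n) x) (I (v n)) (P (v n)) x (X (v n) x)"
    and SD: "SD_condition v I E P M X"
  shows "(\<lambda>n. mean_hitting_time (M (v n)) (X (v n)) (v n) (v 0) /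
              mean_hitting_time (M (v n)) (X (v n)) (v 0) (v n)) \<longlonglongrightarrow> 0"
proof (rule order_tendstoI)
  fix e :: ennreal assume "0 < e"
  obtain \<delta> where \<delta>: "0 < \<delta>" "ennreal \<delta> < e"
  proof (cases e)
    case (real s)
    then show thesis using \<open>0 < e\<close> by (intro that[of "s / 2"]) (auto simp: ennreal_less_iff)
  next
    case top
    then show thesis by (intro that[of 1]) auto
  qed
  define C where "C = 2 / \<delta>"
  obtain k where k: "0 < k"
    and inf: "\<And>n. 1 \<le> n \<Longrightarrow> k \<le> (INF b\<in>branch (I (v n)) (E (v n)) (v 0) (alpha (E (v n)) (v 0) (v n)).
      death_rate (E (v n)) (v 0) (P (v n)) b)"
    and lim: "(\<lambda>n. (SD_sup (I (v n)) (E (v n)) (v 0) (P (v n)) (M (v n)) (X (v n)) (v n))\<^sup>2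
      / mean_hitting_time (M (v n)) (X (v n)) (v n) (v 0)) \<longlonglongrightarrow> 0"
    using SD unfolding SD_condition_def Let_def by auto
  have "0 < k / (2 * (C + 1))" using k \<delta> by (simp add: C_def field_simps)
  then have "\<forall>\<^sub>F n in sequentially.
      (SD_sup (I (v n)) (E (v n)) (v 0) (P (v n)) (M (v n)) (X (v n)) (v n))\<^sup>2
      / mean_hitting_time (M (v n)) (X (v n)) (v n) (v 0) < ennreal (k / (2 * (C + 1)))"
    using lim by (intro order_tendstoD(2)) auto
  with eventually_ge_at_top[of 1] show "\<forall>\<^sub>F n in sequentially.
      mean_hitting_time (M (v n)) (X (v n)) (v n) (v 0) /
      mean_hitting_time (M (v n)) (X (v n)) (v 0) (v n) < e"
  proof eventually_elim
    case (elim n)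
    interpret bd_process "I (v n)" "E (v n)" "v 0" "P (v n)" "M (v n)" "X (v n)"
      by unfold_locales (use tree kernel chain elim(1) in auto)
    have "mean_hitting_time (M (v n)) (X (v n)) (v n) (v 0) /
      mean_hitting_time (M (v n)) (X (v n)) (v 0) (v n) \<le> ennreal (2 / C)"
    proof (rule hitting_ratio_le[OF elim(1) refl path _ _ k _ _ elim(2)])
      show "v j \<in> I (v n)" if "j \<le> n" for j using path_in elim(1) that .
      show "par (v j) = v (j - 1)" if "1 \<le> j" "j \<le> n" for j using path_parent that .
      show "0 < C" using \<delta> by (simp add: C_def)
      fix b assume b: "b \<in> branch (I (v n)) (E (v n)) (v 0) (alpha (E (v n)) (v 0) (v n))"
      have "(INF b\<in>branch (I (v n)) (E (v n)) (v 0) (alpha (E (v n)) (v 0) (v n)). death b) \<le> death b"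
        using b by (intro cINF_lower bdd_belowI2[where m = 0]) (auto simp: death_rate_def)
      then show "k \<le> death b" using inf[OF elim(1)] by simp
    qed
    also have "\<dots> < e" using \<delta> by (simp add: C_def)
    finally show ?case .
  qed
qed simp

end
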